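(* Given on input a target tolerance $\epsilon>0$, the MDL algorithm (with control parameter $\gamma\in(0,1)$) applied to the vector field $g$ terminates after finitely many steps, with output $y^t=\{y_\tau,g(y_\tau)\}_{\tau=1}^t$, $y_\tau\in Y$, and $\lambda^t=\{\lambda^t_\tau\ge0\}_{\tau=1}^t$, $\sum_{\tau=1}^t\lambda^t_\tau=1$, such that $$\epsilon(y^t,\lambda^t):=\max_{y\in Y}\sum_{\tau=1}^t\lambda^t_\tau\langle g(y_\tau),y_\tau-y\rangle\le\epsilon .$$ The number of steps of the algorithm does not exceed $$N=\frac{2\Omega^2L^2[g]}{\gamma^4(1-\gamma^2)\epsilon^2}+1 .$$
   Context: Setup. $E_y$ is a Euclidean space with inner product $\langle\cdot,\cdot\rangle$, $Y\subset E_y$ is a nonempty convex compact set, $\|\cdot\|$ is a norm on $E_y$ with conjugate (dual) norm $\|\cdot\|_*$. $\omega:Y\to\mathbf{R}$ is a distance-generating function: it is continuous and convex on $Y$, admits a selection $\omega'(y)\in\partial\omega(y)$ of subgradients that is continuous in $y\in Y^o:=\{y\in Y:\partial\omega(y)\ne\emptyset\}$, and satisfies $\langle\omega'(y)-\omega'(y'),y-y'\rangle\ge\|y-y'\|^2$ for all $y,y'\in Y^o$. Put $y_\omega=\mathrm{argmin}_{y\in Y}\omega(y)$ and $\Omega=\Omega[Y,\omega(\cdot)]:=\sqrt{2[\max_{Y}\omega-\min_{Y}\omega]}$. The vector field $g:Y\to E_y$ is bounded: $\|g(y)\|_*\le L[g]<\infty$ for all $y\in Y$ (no other assumption on $g$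 is made). MDL algorithm. Parameters: tolerance $\epsilon>0$ and $\gamma\in(0,1)$. Write $h_\tau(z)=\langle g(y_\tau),y_\tau-z\rangle$. Initialization: $y_1=y_\omega$, $I_0=\emptyset$, $\Delta_0=+\infty$; steps are grouped into consecutive phases $s=1,2,\dots$ At step $t=1,2,\dots$: 1. Given $y_t$, compute $g(y_t)$ and set $I_t^+=I_{t-1}\cup\{t\}$. 2. Solve $$\epsilon_t=\max_{y\in Y}\min_{\tau\in I_t^+}h_\tau(y),$$ obtaining $\epsilon_t$ together with weights $\lambda^t_\tau\ge0$, $\tau\in I_t^+$, summing up to 1, such that $\epsilon_t=\max_{y\in Y}\sum_{\tau\in I_t^+}\lambda^t_\tau h_\tau(y)$ (these exist by the von Neumann minimax lemma). Set $\lambda^t_\tau=0$ for $\tau\le t$, $\tau\notin I_t^+$. If $\epsilon_t\le\epsilon$, terminate and output $y^t=\{y_\tau,g(y_\tau)\}_{\tau=1}^t$ and $\lambda^t=\{\lambda^t_\tau\}_{\tau=1}^t$. 3. Otherwise: let $s-1$ be the number of phases started before step $t$. If (case A) $\epsilon_t\le\gamma\Delta_{s-1}$, then step $t$ starts phase $s$ (in particular, step $t=1$ starts phase 1), and we set $\Delta_s=\epsilon_t$, $I_t=\{\tau:1\le\tau\le t,\ \lambda^t_\tau>0\}\cup\{1\}$, $\widehat{y}_t=y_\omega$. Otherwise (case B), set $I_t=I_t^+$, $\widehat{y}_t=y_t$. 4. Set $\ell_t=\gamma\epsilon_t$, $U_t=\{y\in Y:h_\tau(y)\ge\ell_t\ \forall\tau\in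 I_t\}$, and $$y_{t+1}=\mathrm{argmin}_{y\in U_t}\left[\omega(y)-\langle\omega'(\widehat{y}_t),y\rangle\right],$$ and pass to step $t+1$. (One has $y_t\in Y^o$ for all $t$, so that $\omega'(\widehat y_t)$ is well defined.) *)

theory Defs
  imports "HOL-Analysis.Analysis"
begin

text \<open>Suprema and infima over \<open>Y\<close> below render max and min: they are only applied to continuous
  functions on a nonempty compact \<open>Y\<close>, where they are attained.\<close>

definition is_norm :: "('a::real_vector \<Rightarrow> real) \<Rightarrow> bool" where
  "is_norm nrm \<longleftrightarrow>
     (\<forall>x. nrm x = 0 \<longleftrightarrow> x = 0) \<and>
     (\<forall>c x. nrm (c *\<^sub>R x) = \<bar>c\<bar> * nrm x) \<and>
     (\<forall>x y. nrm (x + y) \<le> nrm x + nrm y)"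

definition dual_norm :: "('a::euclidean_space \<Rightarrow> real) \<Rightarrow> 'a \<Rightarrow> real" where
  "dual_norm nrm \<xi> = (SUP x\<in>{x. nrm x \<le> 1}. \<xi> \<bullet> x)"

text \<open>The subdifferential is that of \<open>\<omega>\<close> extended by \<open>+\<infinity>\<close> outside \<open>Y\<close>.\<close>

definition subdiff :: "'a::euclidean_space set \<Rightarrow> ('a \<Rightarrow> real) \<Rightarrow> 'a \<Rightarrow> 'a set" where
  "subdiff Y \<omega> y = {\<xi>. \<forall>z\<in>Y. \<omega> z \<ge> \<omega> y + \<xi> \<bullet> (z - y)}"

definition subdiff_dom :: "'a::euclidean_space set \<Rightarrow> ('a \<Rightarrow> real) \<Rightarrow> 'a set" where
  "subdiff_dom Y \<omega> = {y\<in>Y. subdiff Y \<omega> y \<noteq> {}}"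

text \<open>\<open>\<omega>'\<close> is the chosen selection of subgradients; its values outside \<open>subdiff_dom Y \<omega>\<close> are
  irrelevant.\<close>

definition dist_gen_fun ::
  "'a::euclidean_space set \<Rightarrow> ('a \<Rightarrow> real) \<Rightarrow> ('a \<Rightarrow> real) \<Rightarrow> ('a \<Rightarrow> 'a) \<Rightarrow> bool" where
  "dist_gen_fun Y nrm \<omega> \<omega>' \<longleftrightarrow>
     continuous_on Y \<omega> \<and> convex_on Y \<omega> \<and>
     (\<forall>y\<in>subdiff_dom Y \<omega>. \<omega>' y \<in> subdiff Y \<omega> y) \<and>
     continuous_on (subdiff_dom Y \<omega>) \<omega>' \<and>
     (\<forall>y\<in>subdiff_dom Y \<omega>. \<forall>y'\<in>subdiff_dom Y \<omega>.
        (\<omega>' y - \<omega>' y') \<bullet> (y - y') \<ge> (nrm (y - y'))\<^sup>2)"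

definition prox_center :: "'a set \<Rightarrow> ('a \<Rightarrow> real) \<Rightarrow> 'a" where
  "prox_center Y \<omega> = arg_min_on \<omega> Y"

definition prox_width :: "'a set \<Rightarrow> ('a \<Rightarrow> real) \<Rightarrow> real" where
  "prox_width Y \<omega> = sqrt (2 * ((SUP y\<in>Y. \<omega> y) - (INF y\<in>Y. \<omega> y)))"

text \<open>An execution protocol lists the pairs \<open>(y\<^sub>\<tau>, g(y\<^sub>\<tau>))\<close>, \<open>1 \<le> \<tau> \<le> t\<close>; values at
  other indices are ignored.\<close>

definition residual ::
  "'a::euclidean_space set \<Rightarrow> nat \<Rightarrow> (nat \<Rightarrow> 'a \<times> 'a) \<Rightarrow> (nat \<Rightarrow> real) \<Rightarrow> real" where
  "residual Y t P lam =
     (SUP z\<in>Y. \<Sum>\<tau>=1..t. lam \<tau> * (snd (P \<tau>) \<bullet> (fst (P \<tau>) - z)))"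

definition lin_form ::
  "('a::euclidean_space \<Rightarrow> 'a) \<Rightarrow> (nat \<Rightarrow> 'a) \<Rightarrow> nat \<Rightarrow> 'a \<Rightarrow> real" where
  "lin_form g y \<tau> z = g (y \<tau>) \<bullet> (y \<tau> - z)"

definition bundle_gap :: "'a set \<Rightarrow> (nat \<Rightarrow> 'a \<Rightarrow> real) \<Rightarrow> nat set \<Rightarrow> real" where
  "bundle_gap Y h J = (SUP z\<in>Y. MIN \<tau>\<in>J. h \<tau> z)"

definition bundle_weights ::
  "'a set \<Rightarrow> (nat \<Rightarrow> 'a \<Rightarrow> real) \<Rightarrow> nat \<Rightarrow> nat set \<Rightarrow> (nat \<Rightarrow> real) \<Rightarrow> bool" where
  "bundle_weights Y h t J lam \<longleftrightarrow>
     (\<forall>\<tau>\<in>J. lam \<tau> \<ge> 0) \<and> (\<Sum>\<tau>\<in>J. lam \<tau>) = 1 \<and>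
     bundle_gap Y h J = (SUP z\<in>Y. \<Sum>\<tau>\<in>J. lam \<tau> * h \<tau> z) \<and>
     (\<forall>\<tau>\<in>{1..t} - J. lam \<tau> = 0)"

definition level_set :: "'a set \<Rightarrow> (nat \<Rightarrow> 'a \<Rightarrow> real) \<Rightarrow> nat set \<Rightarrow> real \<Rightarrow> 'a set" where
  "level_set Y h J l = {z\<in>Y. \<forall>\<tau>\<in>J. h \<tau> z \<ge> l}"

definition prox_step ::
  "'a::euclidean_space set \<Rightarrow> ('a \<Rightarrow> real) \<Rightarrow> ('a \<Rightarrow> 'a) \<Rightarrow> 'a set \<Rightarrow> 'a \<Rightarrow> 'a \<Rightarrow> bool" where
  "prox_step Y \<omega> \<omega>' U yhat x \<longleftrightarrow>
     yhat \<in> subdiff_dom Y \<omega> \<and> is_arg_min (\<lambda>z. \<omega> z - \<omega>' yhat \<bullet> z) (\<lambda>z. z \<in> U) x"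

text \<open>\<open>At_Step t y I k \<Delta>\<close> is the situation on entry to step \<open>t\<close>: \<open>y 1, \<dots>, y t\<close> are the
  search points (other values of \<open>y\<close> are never read), \<open>I\<close> is \<open>I\<^bsub>t-1\<^esub>\<close>, \<open>k\<close> is the number of
  phases started before step \<open>t\<close>, and \<open>\<Delta> 0, \<dots>, \<Delta> k\<close> are the phase gaps set so far.
  \<open>Finished t P lam\<close> is the situation after termination at step \<open>t\<close> with output \<open>P\<close>, \<open>lam\<close>.\<close>

datatype 'a mdl_config =
    At_Step nat "nat \<Rightarrow> 'a" "nat set" nat "nat \<Rightarrow> ereal"
  | Finished nat "nat \<Rightarrow> 'a \<times> 'a" "nat \<Rightarrow> real"

definition mdl_start :: "'a set \<Rightarrow> ('a \<Rightarrow> real) \<Rightarrow> 'a mdl_config" where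
  "mdl_start Y \<omega> = At_Step 1 (\<lambda>_. prox_center Y \<omega>) {} 0 (\<lambda>_. \<infinity>)"

text \<open>One transition is one step of the algorithm, the terminating step included. It is a relation
  because the optimal weights \<open>lam\<close> need not be unique: any of them may be returned. The guard
  in \<open>prox_step\<close> lets a transition evaluate \<open>\<omega>'\<close> only where the selection is defined.\<close>

inductive mdl_step ::
  "'a::euclidean_space set \<Rightarrow> ('a \<Rightarrow> real) \<Rightarrow> ('a \<Rightarrow> 'a) \<Rightarrow> ('a \<Rightarrow> 'a) \<Rightarrow> real \<Rightarrow> real
    \<Rightarrow> 'a mdl_config \<Rightarrow> 'a mdl_config \<Rightarrow> bool"
  for Y \<omega> \<omega>' g \<epsilon> \<gamma> where
  terminate:
    "bundle_weights Y (lin_form g y) t (insert t I) lam \<Longrightarrow>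
     bundle_gap Y (lin_form g y) (insert t I) \<le> \<epsilon> \<Longrightarrow>
     mdl_step Y \<omega> \<omega>' g \<epsilon> \<gamma> (At_Step t y I k \<Delta>) (Finished t (\<lambda>\<tau>. (y \<tau>, g (y \<tau>))) lam)"
| new_phase:
    "bundle_weights Y (lin_form g y) t (insert t I) lam \<Longrightarrow>
     \<epsilon>\<^sub>t = bundle_gap Y (lin_form g y) (insert t I) \<Longrightarrow>
     \<epsilon>\<^sub>t > \<epsilon> \<Longrightarrow>
     ereal \<epsilon>\<^sub>t \<le> ereal \<gamma> * \<Delta> k \<Longrightarrow>
     J = {\<tau>. 1 \<le> \<tau> \<and> \<tau> \<le> t \<and> lam \<tau> > 0} \<union> {1} \<Longrightarrow>
     prox_step Y \<omega> \<omega>' (level_set Y (lin_form g y) J (\<gamma> * \<epsilon>\<^sub>t)) (prox_center Y \<omega>) x \<Longrightarrow>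
     mdl_step Y \<omega> \<omega>' g \<epsilon> \<gamma> (At_Step t y I k \<Delta>)
       (At_Step (Suc t) (y(Suc t := x)) J (Suc k) (\<Delta>(Suc k := ereal \<epsilon>\<^sub>t)))"
| same_phase:
    "bundle_weights Y (lin_form g y) t (insert t I) lam \<Longrightarrow>
     \<epsilon>\<^sub>t = bundle_gap Y (lin_form g y) (insert t I) \<Longrightarrow>
     \<epsilon>\<^sub>t > \<epsilon> \<Longrightarrow>
     \<not> ereal \<epsilon>\<^sub>t \<le> ereal \<gamma> * \<Delta> k \<Longrightarrow>
     prox_step Y \<omega> \<omega>' (level_set Y (lin_form g y) (insert t I) (\<gamma> * \<epsilon>\<^sub>t)) (y t) x \<Longrightarrow>
     mdl_step Y \<omega> \<omega>' g \<epsilon> \<gamma> (At_Step t y I k \<Delta>)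
       (At_Step (Suc t) (y(Suc t := x)) (insert t I) k \<Delta>)"

end

theory Submission
  imports Defs
begin

text \<open>
  The argument is a potential argument inside each phase, followed by a geometric sum over the
  phases.

  Let \<open>\<Delta>\<close> be the gap at which a phase starts. Within the phase the bundle only grows, so the gaps
  decrease, and all of them exceed \<open>\<gamma> * \<Delta>\<close>, for otherwise a new phase would start. A point \<open>u\<close>
  that attains the latest gap therefore has all linear forms above \<open>\<gamma> * \<Delta>\<close>, and it belongs to
  every level set used in the phase so far, since the levels are \<open>\<gamma>\<close> times gaps that are at most
  \<open>\<Delta>\<close>. Each step is a Bregman projection on such a set. By the three-point inequality
  (\<open>prox_step_three_point\<close>) it lowers the Bregman distance to \<open>u\<close> by at least the Bregman distance
  between the old and the new point, which is at least half their squared distance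
  (\<open>bregman_strong_convexity\<close>). The linear form of the old point vanishes there and is at least
  \<open>\<gamma> * (\<gamma> * \<Delta>)\<close> at the new point, and it is \<open>L\<close>-Lipschitz; so every step lowers the distance
  by at least \<open>\<gamma> ^ 4 * \<Delta>\<^sup>2 / (2 * L\<^sup>2)\<close> (\<open>prox_step_decrease\<close>). A phase starts at the prox-center,
  with Bregman distance at most \<open>\<Omega>\<^sup>2 / 2\<close> (\<open>bregman_prox_center_le\<close>), and hence has at most
  \<open>\<Omega>\<^sup>2 * L\<^sup>2 / (\<gamma> ^ 4 * \<Delta>\<^sup>2)\<close> steps.

  When a phase is opened, the pieces of zero weight are dropped without raising the gap
  (\<open>positive_weights_keep_gap\<close>). From phase to phase \<open>\<Delta>\<close> shrinks by the factor \<open>\<gamma>\<close> at least, and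
  it stays above \<open>\<epsilon>\<close>; the phase bounds are dominated by a geometric series of ratio \<open>\<gamma>\<^sup>2\<close>, counted
  backwards from the last phase, with sum \<open>\<Omega>\<^sup>2 * L\<^sup>2 / (\<gamma> ^ 4 * (1 - \<gamma>\<^sup>2) * \<epsilon>\<^sup>2)\<close>. The terminating
  step adds one. The predicate \<open>invariant\<close> carries this count along a run.

  That the run never gets stuck before it has finished needs two facts of convex analysis. Optimal
  weights exist by a minimax theorem for finitely many affine functions (\<open>minimax_affine\<close>). The
  search points admit subgradients, even on the boundary of \<open>Y\<close>, because each level set contains a
  strictly feasible point (\<open>constrained_minimizer_in_subdiff_dom\<close>).
\<close>

section \<open>Norms and dual norms\<close>

lemma is_norm_nonneg:
  assumes "is_norm nrm"
  shows "0 \<le> nrm x"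
proof -
  have "nrm (x + (-1) *\<^sub>R x) \<le> nrm x + \<bar>-1\<bar> * nrm x"
    using assms unfolding is_norm_def by metis
  moreover have "nrm (x + (-1) *\<^sub>R x) = 0"
    using assms by (simp add: is_norm_def)
  ultimately show ?thesis by simp
qed

lemma is_norm_zero:
  assumes "is_norm nrm"
  shows "nrm 0 = 0"
  using assms unfolding is_norm_def by blast

lemma is_norm_pos:
  assumes "is_norm nrm" "x \<noteq> 0"
  shows "0 < nrm x"
  using assms is_norm_nonneg[OF assms(1), of x] by (auto simp: is_norm_def less_le)

lemma is_norm_continuous_on:
  fixes nrm :: "'a::euclidean_space \<Rightarrow> real"
  assumes "is_norm nrm"
  shows "continuous_on S nrm"
proof -
  have "convex_on UNIV nrm"
  proof (rule convex_onI)
    fix t :: real and x y :: 'a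
    assume "0 < t" "t < 1"
    then show "nrm ((1 - t) *\<^sub>R x + t *\<^sub>R y) \<le> (1 - t) * nrm x + t * nrm y"
      using assms unfolding is_norm_def
      by (metis abs_of_pos diff_gt_0_iff_gt)
  qed simp
  then have "continuous_on UNIV nrm"
    by (intro convex_on_continuous) auto
  then show ?thesis
    using continuous_on_subset by blast
qed

lemma is_norm_lower_bound:
  fixes nrm :: "'a::euclidean_space \<Rightarrow> real"
  assumes "is_norm nrm"
  obtains c where "c > 0" "\<And>x. c * norm x \<le> nrm x"
proof -
  obtain e :: 'a where "e \<in> sphere 0 1"
    using vector_choose_size[of 1] by auto
  then obtain s :: 'a where s: "s \<in> sphere 0 1" "\<And>x. x \<in> sphere 0 1 \<Longrightarrow> nrm s \<le> nrm x"
    using continuous_attains_inf[of "sphere 0 1" nrm] is_norm_continuous_on[OF assms]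
    by (metis compact_sphere empty_iff)
  have "s \<noteq> 0" using s(1) by auto
  then have pos: "nrm s > 0"
    by (rule is_norm_pos[OF assms])
  have "nrm s * norm x \<le> nrm x" for x
  proof (cases "x = 0")
    case False
    then have "nrm s \<le> nrm ((1 / norm x) *\<^sub>R x)"
      by (intro s(2)) simp
    also have "\<dots> = nrm x / norm x"
      using assms by (simp add: is_norm_def)
    finally show ?thesis
      using False by (simp add: field_simps)
  qed (simp add: is_norm_zero[OF assms])
  then show ?thesis
    using pos that by blast
qed

lemma inner_le_dual_norm:
  fixes nrm :: "'a::euclidean_space \<Rightarrow> real"
  assumes "is_norm nrm"
  shows "\<xi> \<bullet> x \<le> dual_norm nrm \<xi> * nrm x"
proof (cases "x = 0")
  case False
  obtain c where c: "c > 0" "\<And>x. c * norm x \<le> nrm x"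
    using is_norm_lower_bound[OF assms] by blast
  have "bdd_above ((\<lambda>x. \<xi> \<bullet> x) ` {x. nrm x \<le> 1})"
  proof (rule bdd_aboveI2)
    fix x assume "x \<in> {x. nrm x \<le> 1}"
    then have "c * norm x \<le> 1"
      using c(2)[of x] by simp
    then have "norm x \<le> 1 / c"
      using c(1) by (simp add: field_simps)
    then show "\<xi> \<bullet> x \<le> norm \<xi> * (1 / c)"
      by (meson norm_cauchy_schwarz norm_ge_zero mult_left_mono order_trans)
  qed
  moreover have pos: "nrm x > 0"
    by (rule is_norm_pos[OF assms False])
  moreover have "nrm ((1 / nrm x) *\<^sub>R x) = \<bar>1 / nrm x\<bar> * nrm x"
    using assms unfolding is_norm_def by blast
  then have "nrm ((1 / nrm x) *\<^sub>R x) = 1"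
    using pos by simp
  ultimately have "\<xi> \<bullet> ((1 / nrm x) *\<^sub>R x) \<le> dual_norm nrm \<xi>"
    unfolding dual_norm_def by (intro cSUP_upper) auto
  then show ?thesis
    using pos by (simp add: field_simps)
qed (simp add: is_norm_zero[OF assms])

section \<open>Subgradients at constrained minimizers\<close>

text \<open>
  The set \<open>D\<close> of all \<open>(z - p, r)\<close> with \<open>z \<in> Y\<close>, \<open>p \<in> P\<close>, \<open>r \<ge> f z - f y\<close> has the origin on its
  relative boundary, because \<open>y\<close> is minimal. A supporting hyperplane there is not vertical: a
  vertical one would separate \<open>Y\<close> from \<open>P\<close> properly, which a common relatively interior point
  excludes. Its slope gives the subgradient. Taking \<open>P\<close> to be a single point
  gives subgradients at relatively interior points of \<open>Y\<close>.
\<close>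

lemma constrained_minimizer_in_subdiff_dom:
  fixes Y P :: "'a::euclidean_space set"
  assumes Y: "convex Y" and P: "convex P" and f: "convex_on Y f"
    and y: "y \<in> Y" "y \<in> P" and min: "\<And>z. z \<in> Y \<Longrightarrow> z \<in> P \<Longrightarrow> f y \<le> f z"
    and slater: "w \<in> rel_interior Y" "w \<in> rel_interior P"
  shows "y \<in> subdiff_dom Y f"
proof -
  define D where "D = {(z - p, r) |z p r. z \<in> Y \<and> p \<in> P \<and> f z - f y \<le> r}"
  have "convex D"
  proof (rule convexI)
    fix d e :: "'a \<times> real" and u v :: real
    assume "d \<in> D" "e \<in> D" and uv: "0 \<le> u" "0 \<le> v" "u + v = 1"
    then obtain z p r z' p' r' where
      d: "d = (z - p, r)" "z \<in> Y" "p \<in> P" "f z - f y \<le> r" and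
      e: "e = (z' - p', r')" "z' \<in> Y" "p' \<in> P" "f z' - f y \<le> r'"
      unfolding D_def by blast
    have v: "v = 1 - u" using uv by simp
    have "f (u *\<^sub>R z + v *\<^sub>R z') \<le> u * f z + v * f z'"
      using f uv d e unfolding convex_on_def by blast
    also have "\<dots> \<le> u * (r + f y) + v * (r' + f y)"
      using d e uv by (intro add_mono mult_left_mono) auto
    finally have "f (u *\<^sub>R z + v *\<^sub>R z') - f y \<le> u * r + v * r'"
      unfolding v by (simp add: algebra_simps)
    moreover have "u *\<^sub>R d + v *\<^sub>R e =
        ((u *\<^sub>R z + v *\<^sub>R z') - (u *\<^sub>R p + v *\<^sub>R p'), u * r + v * r')"
      by (simp add: d e algebra_simps)
    moreover have "u *\<^sub>R z + v *\<^sub>R z' \<in> Y" "u *\<^sub>R p + v *\<^sub>R p' \<in> P"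
      using Y P d e uv unfolding convex_def by blast+
    ultimately show "u *\<^sub>R d + v *\<^sub>R e \<in> D"
      unfolding D_def by blast
  qed
  have memD: "(z - p, r) \<in> D" if "z \<in> Y" "p \<in> P" "f z - f y \<le> r" for z p r
    using that unfolding D_def by blast
  have origin: "0 \<in> D"
    using memD[OF y, of 0] by (simp add: zero_prod_def)
  have "0 \<notin> rel_interior D"
  proof
    assume "0 \<in> rel_interior D"
    moreover have up: "(0, 1) \<in> D"
      using memD[OF y, of 1] by simp
    then have "(0, 1) \<in> affine hull D"
      by (simp add: hull_inc)
    ultimately obtain e where "e > 1" "(1 - e) *\<^sub>R (0, 1) + e *\<^sub>R 0 \<in> D"
      using convex_rel_interior_if2[OF \<open>convex D\<close>] by blast
    then have e: "e > 1" "(0, 1 - e) \<in> D"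
      by simp_all
    then obtain z where "z \<in> Y" "z \<in> P" "f z - f y \<le> 1 - e"
      unfolding D_def by auto
    then show False
      using min[of z] e by linarith
  qed
  then obtain q where "\<And>d. d \<in> D \<Longrightarrow> q \<bullet> 0 \<le> q \<bullet> d"
    and strict': "\<And>d. d \<in> rel_interior D \<Longrightarrow> q \<bullet> 0 < q \<bullet> d"
    using supporting_hyperplane_rel_boundary[OF \<open>convex D\<close> origin] by metis
  then obtain a b where q: "q = (a, b)" and
    supp: "\<And>z p r. z \<in> Y \<Longrightarrow> p \<in> P \<Longrightarrow> f z - f y \<le> r \<Longrightarrow> 0 \<le> a \<bullet> (z - p) + b * r"
    using memD by (cases q) fastforce
  have strict: "0 < q \<bullet> d" if "d \<in> rel_interior D" for d
    using strict'[OF that] by simp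
  have "b \<ge> 0"
    using supp[OF y, of 1] by simp
  moreover have "b \<noteq> 0"
  proof
    assume "b = 0"
    obtain d where d: "d \<in> rel_interior D"
      using \<open>convex D\<close> origin rel_interior_eq_empty by blast
    then obtain z p r where zpr: "d = (z - p, r)" "z \<in> Y" "p \<in> P"
      using rel_interior_subset unfolding D_def by blast
    have gap: "0 < a \<bullet> (z - p)"
      using strict[OF d] zpr \<open>b = 0\<close> q by simp
    \<comment> \<open>Prolonging both segments through \<open>w\<close> by the same factor reverses the sign of the gap.\<close>
    obtain m where m: "m > 1" "\<And>e. e > 1 \<Longrightarrow> e \<le> m \<Longrightarrow> (1 - e) *\<^sub>R z + e *\<^sub>R w \<in> Y"
      using bspec[OF convex_rel_interior_if[OF Y slater(1)] hull_inc[OF zpr(2)]] by auto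
    obtain n where n: "n > 1" "\<And>e. e > 1 \<Longrightarrow> e \<le> n \<Longrightarrow> (1 - e) *\<^sub>R p + e *\<^sub>R w \<in> P"
      using bspec[OF convex_rel_interior_if[OF P slater(2)] hull_inc[OF zpr(3)]] by auto
    define e where "e = min m n"
    have e: "e > 1" "e \<le> m" "e \<le> n"
      using m n by (auto simp: e_def)
    have "0 \<le> a \<bullet> (((1 - e) *\<^sub>R z + e *\<^sub>R w) - ((1 - e) *\<^sub>R p + e *\<^sub>R w))"
      using supp[OF m(2)[OF e(1,2)] n(2)[OF e(1,3)] order_refl] unfolding \<open>b = 0\<close> by simp
    also have "\<dots> = (1 - e) * (a \<bullet> (z - p))"
      by (simp add: algebra_simps)
    finally show False
      using gap e by (simp add: zero_le_mult_iff)
  qed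
  ultimately have "b > 0" by simp
  have "- (a /\<^sub>R b) \<in> subdiff Y f y"
  proof -
    have "f y + - (a /\<^sub>R b) \<bullet> (z - y) \<le> f z" if "z \<in> Y" for z
    proof -
      have "0 \<le> a \<bullet> (z - y) + b * (f z - f y)"
        using supp[OF that y(2) order_refl] .
      then show ?thesis
        using \<open>b > 0\<close> by (simp add: field_simps)
    qed
    then show ?thesis
      by (simp add: subdiff_def)
  qed
  then show ?thesis
    using y by (auto simp: subdiff_dom_def)
qed

lemma rel_interior_subset_subdiff_dom:
  fixes Y :: "'a::euclidean_space set"
  assumes "convex Y" "convex_on Y f"
  shows "rel_interior Y \<subseteq> subdiff_dom Y f"
proof
  fix y assume y: "y \<in> rel_interior Y"
  show "y \<in> subdiff_dom Y f"
    by (rule constrained_minimizer_in_subdiff_dom[where P = "{y}" and w = y])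
      (use assms y rel_interior_subset in auto)
qed

lemma subdiff_dom_minus_linear:
  "subdiff_dom Y (\<lambda>z. f z - p \<bullet> z) = subdiff_dom Y f"
proof -
  have "\<xi> \<in> subdiff Y (\<lambda>z. f z - p \<bullet> z) y \<longleftrightarrow> \<xi> + p \<in> subdiff Y f y" for \<xi> y
    by (auto simp: subdiff_def algebra_simps)
  then show ?thesis
    unfolding subdiff_dom_def by (metis (no_types, lifting) all_not_in_conv diff_add_cancel)
qed

lemma convex_on_minus_linear:
  assumes "convex_on Y f"
  shows "convex_on Y (\<lambda>z. f z - p \<bullet> z)"
proof -
  have "convex_on Y (\<lambda>z. - (p \<bullet> z))"
    using convex_on_imp_convex[OF assms]
    by (intro convex_onI) (auto simp: algebra_simps)
  from convex_on_add[OF assms this] show ?thesis by simp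
qed

lemma open_meets_rel_interior:
  fixes Y :: "'a::euclidean_space set"
  assumes "convex Y" "open G" "x \<in> Y" "x \<in> G"
  obtains w where "w \<in> rel_interior Y" "w \<in> G"
  using open_inter_closure_rel_interior[OF assms(1,2)] assms closure_subset by blast

section \<open>Distance-generating functions and Bregman distances\<close>

definition bregman :: "('a::real_inner \<Rightarrow> real) \<Rightarrow> ('a \<Rightarrow> 'a) \<Rightarrow> 'a \<Rightarrow> 'a \<Rightarrow> real" where
  "bregman \<omega> \<omega>' u y = \<omega> u - \<omega> y - \<omega>' y \<bullet> (u - y)"

locale prox_geometry =
  fixes Y :: "'a::euclidean_space set" and nrm \<omega> :: "'a \<Rightarrow> real" and \<omega>' :: "'a \<Rightarrow> 'a"
  assumes Y_nonempty: "Y \<noteq> {}" and Y_convex: "convex Y" and Y_compact: "compact Y"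
    and norm_ax: "is_norm nrm"
    and dgf: "dist_gen_fun Y nrm \<omega> \<omega>'"
begin

lemma \<omega>_continuous: "continuous_on Y \<omega>"
  and \<omega>_convex: "convex_on Y \<omega>"
  and \<omega>'_continuous: "continuous_on (subdiff_dom Y \<omega>) \<omega>'"
  using dgf unfolding dist_gen_fun_def by blast+

lemma subgradient_ineq:
  assumes "y \<in> subdiff_dom Y \<omega>" "z \<in> Y"
  shows "\<omega> y + \<omega>' y \<bullet> (z - y) \<le> \<omega> z"
  using dgf assms unfolding dist_gen_fun_def subdiff_def by blast

lemma strongly_monotone:
  assumes "y \<in> subdiff_dom Y \<omega>" "y' \<in> subdiff_dom Y \<omega>"
  shows "(nrm (y - y'))\<^sup>2 \<le> (\<omega>' y - \<omega>' y') \<bullet> (y - y')"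
  using dgf assms unfolding dist_gen_fun_def by blast

lemma rel_interior_dom: "rel_interior Y \<subseteq> subdiff_dom Y \<omega>"
  using rel_interior_subset_subdiff_dom[OF Y_convex \<omega>_convex] .

text \<open>
  First-order optimality for the selected subgradient. For an arbitrary subgradient at \<open>y\<close> it may
  fail, as the subdifferential at a boundary point of \<open>Y\<close> contains normal directions. At the
  points of the segment from \<open>y\<close> to \<open>u\<close>, which admit subgradients because \<open>u\<close> is relatively
  interior, the subgradient inequality and minimality give the claim; continuity of the selection
  carries it back to \<open>y\<close>.
\<close>

lemma variational_inequality_rel_interior:
  assumes y: "y \<in> subdiff_dom Y \<omega>" and u: "u \<in> rel_interior Y"
    and min: "\<And>t. 0 < t \<Longrightarrow> t \<le> 1 \<Longrightarrow>
      \<omega> y - p \<bullet> y \<le> \<omega> (y + t *\<^sub>R (u - y)) - p \<bullet> (y + t *\<^sub>R (u - y))"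
  shows "0 \<le> (\<omega>' y - p) \<bullet> (u - y)"
proof -
  define s where "s t = y + t *\<^sub>R (u - y)" for t :: real
  have yY: "y \<in> Y" using y by (simp add: subdiff_dom_def)
  have s: "s t \<in> subdiff_dom Y \<omega>" if "0 < t" "t \<le> 1" for t
    using rel_interior_convex_shrink[OF Y_convex u yY that] rel_interior_dom
    by (auto simp: s_def algebra_simps)
  have nonneg: "0 \<le> (\<omega>' (s t) - p) \<bullet> (u - y)" if t: "0 < t" "t \<le> 1" for t
  proof -
    have "\<omega> (s t) + \<omega>' (s t) \<bullet> (y - s t) \<le> \<omega> y"
      using subgradient_ineq[OF s[OF t] yY] .
    moreover have "\<omega> y - p \<bullet> y \<le> \<omega> (s t) - p \<bullet> s t"
      using min[OF t] by (simp add: s_def)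
    ultimately have "0 \<le> (\<omega>' (s t) - p) \<bullet> (s t - y)"
      by (simp add: algebra_simps)
    also have "\<dots> = t * ((\<omega>' (s t) - p) \<bullet> (u - y))"
      by (simp add: s_def)
    finally show ?thesis
      using t by (simp add: zero_le_mult_iff)
  qed
  have "((\<lambda>n. \<omega>' (s (1 / real (Suc n)))) \<longlongrightarrow> \<omega>' y) sequentially"
  proof -
    have "(\<lambda>n. s (1 / real (Suc n))) \<longlonglongrightarrow> y + 0 *\<^sub>R (u - y)"
      unfolding s_def by (intro tendsto_intros LIMSEQ_Suc[OF lim_1_over_n])
    then have "(\<lambda>n. s (1 / real (Suc n))) \<longlonglongrightarrow> y" by simp
    then show ?thesis
      by (rule continuous_on_tendsto_compose[OF \<omega>'_continuous _ y]) (intro always_eventually allI s; simp)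
  qed
  then have "(\<lambda>n. (\<omega>' (s (1 / real (Suc n))) - p) \<bullet> (u - y)) \<longlonglongrightarrow> (\<omega>' y - p) \<bullet> (u - y)"
    by (intro tendsto_intros)
  then show ?thesis
    by (rule LIMSEQ_le_const) (use nonneg in auto)
qed

text \<open>
  Moving \<open>u\<close> slightly towards \<open>w\<close> makes it relatively interior without leaving \<open>U\<close>, and the
  conclusion is closed in \<open>u\<close>.
\<close>

lemma variational_inequality:
  assumes y: "y \<in> subdiff_dom Y \<omega>" and U: "convex U" "U \<subseteq> Y" "y \<in> U"
    and w: "w \<in> U" "w \<in> rel_interior Y"
    and min: "\<And>z. z \<in> U \<Longrightarrow> \<omega> y - p \<bullet> y \<le> \<omega> z - p \<bullet> z"
    and u: "u \<in> U"
  shows "0 \<le> (\<omega>' y - p) \<bullet> (u - y)"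
proof -
  define v where "v n = u - (1 / real (Suc n)) *\<^sub>R (u - w)" for n
  have seg: "a + t *\<^sub>R (b - a) \<in> U" if "a \<in> U" "b \<in> U" "0 < t" "t \<le> 1" for a b and t :: real
  proof -
    have "(1 - t) *\<^sub>R a + t *\<^sub>R b \<in> U"
      using U(1) that unfolding convex_alt by simp
    then show ?thesis by (simp add: algebra_simps)
  qed
  have ge: "0 \<le> (\<omega>' y - p) \<bullet> (v n - y)" for n
  proof (rule variational_inequality_rel_interior[OF y])
    show ri: "v n \<in> rel_interior Y"
      unfolding v_def using u U by (intro rel_interior_convex_shrink Y_convex w) auto
    have "v n \<in> U"
      using seg[OF u w(1), of "1 / real (Suc n)"] by (simp add: v_def algebra_simps)
    then show "\<omega> y - p \<bullet> y \<le> \<omega> (y + t *\<^sub>R (v n - y)) - p \<bullet> (y + t *\<^sub>R (v n - y))"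
      if "0 < t" "t \<le> 1" for t
      using that by (intro min seg U(3))
  qed
  have "v \<longlonglongrightarrow> u - 0 *\<^sub>R (u - w)"
    unfolding v_def by (intro tendsto_intros LIMSEQ_Suc[OF lim_1_over_n])
  then have "(\<lambda>n. (\<omega>' y - p) \<bullet> (v n - y)) \<longlonglongrightarrow> (\<omega>' y - p) \<bullet> (u - y)"
    by (intro tendsto_intros) simp
  then show ?thesis
    by (rule LIMSEQ_le_const) (use ge in auto)
qed

text \<open>
  The strong monotonicity of the selection is integrated along the segment from \<open>y\<close> to \<open>z\<close>. In
  place of an integral, the subgradient inequalities between consecutive points of an equidistant
  subdivision are added up; the \<open>i\<close>-th one gains \<open>i / N\<^sup>2\<close> times \<open>(nrm (z - y))\<^sup>2\<close>, and the total
  tends to half of it.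
\<close>

lemma bregman_strong_convexity_rel_interior:
  assumes y: "y \<in> subdiff_dom Y \<omega>" and z: "z \<in> rel_interior Y"
  shows "(nrm (z - y))\<^sup>2 / 2 \<le> bregman \<omega> \<omega>' z y"
proof -
  define s where "s t = y + t *\<^sub>R (z - y)" for t :: real
  have yY: "y \<in> Y" using y by (simp add: subdiff_dom_def)
  have s: "s t \<in> subdiff_dom Y \<omega>" if "0 \<le> t" "t \<le> 1" for t
  proof (cases "t = 0")
    case False
    then show ?thesis
      using rel_interior_convex_shrink[OF Y_convex z yY, of t] rel_interior_dom that
      by (auto simp: s_def algebra_simps)
  qed (use y in \<open>simp add: s_def\<close>)
  have growth: "\<omega>' y \<bullet> (z - y) + t * (nrm (z - y))\<^sup>2 \<le> \<omega>' (s t) \<bullet> (z - y)"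
    if t: "0 \<le> t" "t \<le> 1" for t
  proof (cases "t = 0")
    case False
    have "(nrm (s t - y))\<^sup>2 \<le> (\<omega>' (s t) - \<omega>' y) \<bullet> (s t - y)"
      by (rule strongly_monotone[OF s[OF t] y])
    moreover have "nrm (s t - y) = t * nrm (z - y)"
      using norm_ax t by (simp add: s_def is_norm_def)
    ultimately have "t * (t * (nrm (z - y))\<^sup>2) \<le> t * ((\<omega>' (s t) - \<omega>' y) \<bullet> (z - y))"
      by (simp add: s_def power_mult_distrib power2_eq_square algebra_simps)
    then have "t * (nrm (z - y))\<^sup>2 \<le> (\<omega>' (s t) - \<omega>' y) \<bullet> (z - y)"
      using False t by simp
    then show ?thesis
      by (simp add: inner_diff_left)
  qed (simp add: s_def)
  have ineq: "\<omega>' y \<bullet> (z - y) + (nrm (z - y))\<^sup>2 * (1 - 1 / real (Suc n)) / 2 \<le> \<omega> z - \<omega> y" for n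
  proof -
    let ?N = "real (Suc n)"
    have step: "(\<omega>' y \<bullet> (z - y)) / ?N + (real i * (nrm (z - y))\<^sup>2) / ?N\<^sup>2
        \<le> \<omega> (s (real (Suc i) / ?N)) - \<omega> (s (real i / ?N))" if "i < Suc n" for i
    proof -
      have t: "0 \<le> real i / ?N" "real i / ?N \<le> 1" "0 \<le> real (Suc i) / ?N" "real (Suc i) / ?N \<le> 1"
        using that by (auto simp: field_simps)
      have "s (real (Suc i) / ?N) - s (real i / ?N) = (1 / ?N) *\<^sub>R (z - y)"
        unfolding s_def add_diff_add scaleR_left_diff_distrib[symmetric]
        by (simp add: diff_divide_distrib[symmetric] del: of_nat_Suc)
      then have "(1 / ?N) * (\<omega>' (s (real i / ?N)) \<bullet> (z - y))
          \<le> \<omega> (s (real (Suc i) / ?N)) - \<omega> (s (real i / ?N))"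
        using subgradient_ineq[OF s[OF t(1,2)], of "s (real (Suc i) / ?N)"] s[OF t(3,4)]
        by (simp add: subdiff_dom_def)
      moreover have "(1 / ?N) * (\<omega>' y \<bullet> (z - y) + (real i / ?N) * (nrm (z - y))\<^sup>2)
          \<le> (1 / ?N) * (\<omega>' (s (real i / ?N)) \<bullet> (z - y))"
        by (intro mult_left_mono growth t) simp
      moreover have "(1 / ?N) * (\<omega>' y \<bullet> (z - y) + (real i / ?N) * (nrm (z - y))\<^sup>2)
          = (\<omega>' y \<bullet> (z - y)) / ?N + (real i * (nrm (z - y))\<^sup>2) / ?N\<^sup>2"
        by (simp add: distrib_left power2_eq_square del: of_nat_Suc)
      ultimately show ?thesis
        by linarith
    qed
    have "(\<Sum>i<Suc n. (\<omega>' y \<bullet> (z - y)) / ?N + (real i * (nrm (z - y))\<^sup>2) / ?N\<^sup>2)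
        \<le> (\<Sum>i<Suc n. \<omega> (s (real (Suc i) / ?N)) - \<omega> (s (real i / ?N)))"
      by (intro sum_mono step) simp
    also have "\<dots> = \<omega> (s (?N / ?N)) - \<omega> (s (0 / ?N))"
      using sum_lessThan_telescope[of "\<lambda>i. \<omega> (s (real i / ?N))" "Suc n"] by simp
    also have "\<dots> = \<omega> z - \<omega> y"
      by (simp add: s_def del: of_nat_Suc)
    also have "(\<Sum>i<Suc n. (\<omega>' y \<bullet> (z - y)) / ?N + (real i * (nrm (z - y))\<^sup>2) / ?N\<^sup>2)
        = \<omega>' y \<bullet> (z - y) + (\<Sum>i<Suc n. real i) * (nrm (z - y))\<^sup>2 / ?N\<^sup>2"
      by (simp only: sum.distrib sum_divide_distrib[symmetric] sum_distrib_right[symmetric]) simp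
    also have "(\<Sum>i<Suc n. real i) = ?N * (?N - 1) / 2"
      by (induction n) (auto simp: field_simps)
    also have "?N * (?N - 1) / 2 * (nrm (z - y))\<^sup>2 / ?N\<^sup>2 = (nrm (z - y))\<^sup>2 * (1 - 1 / ?N) / 2"
      by (simp add: field_simps power2_eq_square del: of_nat_Suc)
    finally show ?thesis .
  qed
  have "(\<lambda>n. \<omega>' y \<bullet> (z - y) + (nrm (z - y))\<^sup>2 * (1 - 1 / real (Suc n)) / 2)
      \<longlonglongrightarrow> \<omega>' y \<bullet> (z - y) + (nrm (z - y))\<^sup>2 * (1 - 0) / 2"
    by (intro tendsto_intros LIMSEQ_Suc[OF lim_1_over_n]) simp
  then have "\<omega>' y \<bullet> (z - y) + (nrm (z - y))\<^sup>2 * (1 - 0) / 2 \<le> \<omega> z - \<omega> y"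
    by (rule LIMSEQ_le_const2) (use ineq in auto)
  then show ?thesis
    by (simp add: bregman_def)
qed

lemma bregman_strong_convexity:
  assumes y: "y \<in> subdiff_dom Y \<omega>" and z: "z \<in> Y"
  shows "(nrm (z - y))\<^sup>2 / 2 \<le> bregman \<omega> \<omega>' z y"
proof -
  obtain w where w: "w \<in> rel_interior Y"
    using rel_interior_eq_empty[OF Y_convex] Y_nonempty by blast
  define v where "v n = z - (1 / real (Suc n)) *\<^sub>R (z - w)" for n
  have v: "v n \<in> rel_interior Y" for n
    unfolding v_def by (intro rel_interior_convex_shrink Y_convex w z) auto
  have "v \<longlonglongrightarrow> z - 0 *\<^sub>R (z - w)"
    unfolding v_def by (intro tendsto_intros LIMSEQ_Suc[OF lim_1_over_n])
  then have lim: "v \<longlonglongrightarrow> z" by simp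
  have "(\<lambda>n. \<omega> (v n)) \<longlonglongrightarrow> \<omega> z"
    by (rule continuous_on_tendsto_compose[OF \<omega>_continuous lim z])
      (use v rel_interior_subset in \<open>blast intro: always_eventually\<close>)
  moreover have "(\<lambda>n. nrm (v n - y)) \<longlonglongrightarrow> nrm (z - y)"
    by (rule continuous_on_tendsto_compose[OF is_norm_continuous_on[OF norm_ax, of UNIV]])
      (auto intro!: tendsto_intros lim)
  ultimately show ?thesis
    unfolding bregman_def
    by (intro LIMSEQ_le[of "\<lambda>n. (nrm (v n - y))\<^sup>2 / 2" _
          "\<lambda>n. \<omega> (v n) - \<omega> y - \<omega>' y \<bullet> (v n - y)"] tendsto_intros lim)
      (use bregman_strong_convexity_rel_interior[OF y v] in \<open>auto simp: bregman_def\<close>)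
qed

end

section \<open>Bundle gaps and optimal weights\<close>

lemma continuous_on_Min:
  fixes h :: "'i \<Rightarrow> 'a::topological_space \<Rightarrow> real"
  assumes "finite J" "J \<noteq> {}" "\<And>\<tau>. \<tau> \<in> J \<Longrightarrow> continuous_on Y (h \<tau>)"
  shows "continuous_on Y (\<lambda>z. MIN \<tau>\<in>J. h \<tau> z)"
  using assms
proof (induction J rule: finite_ne_induct)
  case (insert a J)
  then have "(\<lambda>z. MIN \<tau>\<in>insert a J. h \<tau> z) = (\<lambda>z. min (h a z) (MIN \<tau>\<in>J. h \<tau> z))"
    by (simp add: fun_eq_iff)
  then show ?case
    using insert by (auto intro!: continuous_on_min)
qed simp

lemma bundle_gap_attained:
  fixes Y :: "'a::topological_space set"
  assumes "compact Y" "Y \<noteq> {}" "finite J" "J \<noteq> {}"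
    and "\<And>\<tau>. \<tau> \<in> J \<Longrightarrow> continuous_on Y (h \<tau>)"
  obtains z where "z \<in> Y" "bundle_gap Y h J = (MIN \<tau>\<in>J. h \<tau> z)"
    "\<And>x. x \<in> Y \<Longrightarrow> (MIN \<tau>\<in>J. h \<tau> x) \<le> bundle_gap Y h J"
proof -
  obtain z where z: "z \<in> Y" "\<And>x. x \<in> Y \<Longrightarrow> (MIN \<tau>\<in>J. h \<tau> x) \<le> (MIN \<tau>\<in>J. h \<tau> z)"
    using continuous_attains_sup[OF assms(1,2) continuous_on_Min[of J Y h]] assms(3-5) by blast
  then have "bundle_gap Y h J = (MIN \<tau>\<in>J. h \<tau> z)"
    unfolding bundle_gap_def by (intro cSup_eq_maximum) auto
  then show ?thesis
    using z that by simp
qed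

text \<open>
  The pairs \<open>(a, b)\<close> whose affine function \<open>b - a \<bullet> z\<close> stays below \<open>v\<close> on \<open>Y\<close> form a closed
  convex set \<open>D\<close>. If no convex combination of the given pairs lay in \<open>D\<close>, a hyperplane would
  separate their hull strictly from \<open>D\<close>. Because \<open>D\<close> contains arbitrarily low pairs for every
  slope, the hyperplane is not vertical and amounts to evaluation at a point; because the slopes are
  arbitrary, this point lies in \<open>Y\<close>. All the given functions then exceed \<open>v\<close> there.
\<close>

lemma minimax_affine:
  fixes Y :: "'a::euclidean_space set" and a :: "'i \<Rightarrow> 'a" and b :: "'i \<Rightarrow> real"
  assumes Y: "compact Y" "convex Y" "Y \<noteq> {}" and J: "finite J" "J \<noteq> {}"
    and v: "\<And>z. z \<in> Y \<Longrightarrow> \<exists>\<tau>\<in>J. b \<tau> - a \<tau> \<bullet> z \<le> v"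
  obtains lam where "\<And>\<tau>. \<tau> \<in> J \<Longrightarrow> 0 \<le> lam \<tau>" "sum lam J = 1"
    "\<And>z. z \<in> Y \<Longrightarrow> (\<Sum>\<tau>\<in>J. lam \<tau> * (b \<tau> - a \<tau> \<bullet> z)) \<le> v"
proof -
  define D where "D = {(p, q). \<forall>z\<in>Y. q - p \<bullet> z \<le> v}"
  define C where "C = convex hull ((\<lambda>\<tau>. (a \<tau>, b \<tau>)) ` J)"
  have D_eq: "D = (\<Inter>z\<in>Y. {d. (- z, 1) \<bullet> d \<le> v})"
    by (auto simp: D_def inner_commute)
  have D_closed: "closed D" and D_convex: "convex D"
    unfolding D_eq by (intro closed_INT ballI closed_halfspace_le convex_INT convex_halfspace_le)+
  have C: "convex C" "compact C" "C \<noteq> {}"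
    unfolding C_def using J by (simp_all add: finite_imp_compact_convex_hull)
  have "C \<inter> D \<noteq> {}"
  proof
    assume "C \<inter> D = {}"
    then obtain n s where n: "\<forall>c\<in>C. n \<bullet> c < s" "\<forall>d\<in>D. s < n \<bullet> d"
      using separating_hyperplane_compact_closed[OF C D_convex D_closed] by blast
    obtain p q where pq: "n = (p, q)" by (cases n)
    have C: "p \<bullet> a \<tau> + q * b \<tau> < s" if "\<tau> \<in> J" for \<tau>
    proof -
      have "(a \<tau>, b \<tau>) \<in> C"
        unfolding C_def using that by (intro hull_inc imageI)
      then show ?thesis
        using n(1) by (fastforce simp: pq)
    qed
    have D: "s < p \<bullet> c + q * d" if "(c, d) \<in> D" for c d
      using bspec[OF n(2) that] by (simp add: pq)
    have lowD: "\<exists>m. \<forall>d\<le>m. (c, d) \<in> D" for c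
    proof -
      have "continuous_on Y (\<lambda>z. c \<bullet> z)"
        by (intro continuous_intros)
      then obtain x where x: "x \<in> Y" "\<And>z. z \<in> Y \<Longrightarrow> c \<bullet> x \<le> c \<bullet> z"
        using continuous_attains_inf[OF Y(1,3)] by blast
      have "(c, d) \<in> D" if "d \<le> v + c \<bullet> x" for d
        unfolding D_def using that x(2) by force
      then show ?thesis by blast
    qed
    have "q \<le> 0"
    proof (rule ccontr)
      assume "\<not> q \<le> 0"
      obtain m where m: "\<And>d. d \<le> m \<Longrightarrow> (0, d) \<in> D"
        using lowD[of 0] by blast
      have "(0, min m (s / q)) \<in> D"
        by (rule m) simp
      then have "s < q * min m (s / q)"
        using D by fastforce
      also have "\<dots> \<le> q * (s / q)"
        using \<open>\<not> q \<le> 0\<close> by (intro mult_left_mono) auto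
      finally show False
        using \<open>\<not> q \<le> 0\<close> by simp
    qed
    moreover have "q \<noteq> 0"
    proof
      assume "q = 0"
      then have low: "s < p \<bullet> c" for c
        using lowD[of c] D by fastforce
      obtain \<tau> where "\<tau> \<in> J" using J by blast
      then show False
        using C[of \<tau>] low[of "a \<tau>"] \<open>q = 0\<close> by simp
    qed
    ultimately have "q < 0" by simp
    define x where "x = p /\<^sub>R q"
    define r where "r = s / q"
    have eval: "(p \<bullet> c + q * d) / q = d + c \<bullet> x" for c d
      using \<open>q < 0\<close> by (simp add: x_def inner_commute field_simps)
    have above: "r < b \<tau> + a \<tau> \<bullet> x" if "\<tau> \<in> J" for \<tau>
    proof -
      have "s / q < (p \<bullet> a \<tau> + q * b \<tau>) / q"
        by (rule divide_strict_right_mono_neg[OF C[OF that] \<open>q < 0\<close>])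
      then show ?thesis
        by (simp only: eval r_def)
    qed
    have below: "d + c \<bullet> x < r" if "(c, d) \<in> D" for c d
    proof -
      have "(p \<bullet> c + q * d) / q < s / q"
        by (rule divide_strict_right_mono_neg[OF D[OF that] \<open>q < 0\<close>])
      then show ?thesis
        by (simp only: eval r_def)
    qed
    have "- x \<in> Y"
    proof (rule ccontr)
      assume "- x \<notin> Y"
      then obtain c e where c: "c \<bullet> (- x) < e" "\<And>z. z \<in> Y \<Longrightarrow> e < c \<bullet> z"
        using separating_hyperplane_closed_point[OF Y(2) compact_imp_closed[OF Y(1)]] by blast
      have delta: "0 < e + c \<bullet> x" using c(1) by simp
      \<comment> \<open>A large multiple of the separating slope pushes the value at \<open>- x\<close> above \<open>r\<close>.\<close>
      define t where "t = (\<bar>r\<bar> + \<bar>v\<bar>) / (e + c \<bullet> x)"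
      have "t \<ge> 0" using delta by (simp add: t_def)
      have "v + t * e - (t *\<^sub>R c) \<bullet> z \<le> v" if "z \<in> Y" for z
        using mult_left_mono[OF less_imp_le[OF c(2)[OF that]] \<open>t \<ge> 0\<close>] by simp
      then have "(t *\<^sub>R c, v + t * e) \<in> D"
        by (simp add: D_def)
      from below[OF this] have "v + t * (e + c \<bullet> x) < r"
        by (simp add: algebra_simps)
      then show False
        using delta by (simp add: t_def)
    qed
    then obtain \<tau> where \<tau>: "\<tau> \<in> J" "b \<tau> - a \<tau> \<bullet> (- x) \<le> v"
      using v by blast
    have "v < r"
      using below[of 0 v] by (simp add: D_def)
    then show False
      using above[OF \<tau>(1)] \<tau>(2) by simp
  qed
  then obtain c where "c \<in> C" "c \<in> D" by blast
  then obtain lam where lam: "\<And>\<tau>. \<tau> \<in> J \<Longrightarrow> 0 \<le> lam \<tau>" "sum lam J = 1"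
    "c = (\<Sum>\<tau>\<in>J. lam \<tau> *\<^sub>R (a \<tau>, b \<tau>))"
  proof -
    have "(\<lambda>\<tau>. (a \<tau>, b \<tau>)) ` J = (\<Union>\<tau>\<in>J. {(a \<tau>, b \<tau>)})" by blast
    then have "c \<in> convex hull (\<Union>\<tau>\<in>J. {(a \<tau>, b \<tau>)})"
      using \<open>c \<in> C\<close> unfolding C_def by simp
    also have "\<dots> = {\<Sum>\<tau>\<in>J. lam \<tau> *\<^sub>R s \<tau> |lam s. (\<forall>\<tau>\<in>J. 0 \<le> lam \<tau>) \<and> sum lam J = 1 \<and>
        (\<forall>\<tau>\<in>J. s \<tau> \<in> {(a \<tau>, b \<tau>)})}"
      by (rule convex_hull_finite_union[OF J(1)]) simp
    finally obtain lam s where "\<forall>\<tau>\<in>J. 0 \<le> lam \<tau>" "sum lam J = 1"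
      "c = (\<Sum>\<tau>\<in>J. lam \<tau> *\<^sub>R s \<tau>)" "\<forall>\<tau>\<in>J. s \<tau> = (a \<tau>, b \<tau>)"
      by blast
    then show thesis
      by (intro that[of lam]) (simp_all cong: sum.cong)
  qed
  have "(\<Sum>\<tau>\<in>J. lam \<tau> * (b \<tau> - a \<tau> \<bullet> z)) \<le> v" if "z \<in> Y" for z
  proof -
    have "c = ((\<Sum>\<tau>\<in>J. lam \<tau> *\<^sub>R a \<tau>), (\<Sum>\<tau>\<in>J. lam \<tau> * b \<tau>))"
      unfolding lam(3) by (simp add: prod_eq_iff fst_sum snd_sum)
    then have "(\<Sum>\<tau>\<in>J. lam \<tau> * b \<tau>) - (\<Sum>\<tau>\<in>J. lam \<tau> *\<^sub>R a \<tau>) \<bullet> z \<le> v"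
      using \<open>c \<in> D\<close> that by (simp add: D_def)
    then show ?thesis
      by (simp add: inner_sum_left right_diff_distrib sum_subtractf)
  qed
  then show ?thesis
    using lam that by blast
qed

lemma lin_form_continuous: "continuous_on S (lin_form g y \<tau>)"
  unfolding lin_form_def by (intro continuous_intros)

lemma bundle_weights_exist:
  fixes Y :: "'a::euclidean_space set"
  assumes Y: "compact Y" "convex Y" "Y \<noteq> {}" and J: "finite J" "J \<noteq> {}"
  obtains lam where "bundle_weights Y (lin_form g y) t J lam"
proof -
  let ?h = "lin_form g y" and ?v = "bundle_gap Y (lin_form g y) J"
  obtain x where x: "x \<in> Y" "?v = (MIN \<tau>\<in>J. ?h \<tau> x)"
    "\<And>z. z \<in> Y \<Longrightarrow> (MIN \<tau>\<in>J. ?h \<tau> z) \<le> ?v"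
    using bundle_gap_attained[OF Y(1,3) J, of ?h] lin_form_continuous by blast
  have "\<exists>\<tau>\<in>J. g (y \<tau>) \<bullet> y \<tau> - g (y \<tau>) \<bullet> z \<le> ?v" if "z \<in> Y" for z
    using x(3)[OF that] J by (auto simp: Min_le_iff lin_form_def inner_diff_right)
  then obtain lam where lam: "\<And>\<tau>. \<tau> \<in> J \<Longrightarrow> 0 \<le> lam \<tau>" "sum lam J = 1"
    "\<And>z. z \<in> Y \<Longrightarrow> (\<Sum>\<tau>\<in>J. lam \<tau> * (g (y \<tau>) \<bullet> y \<tau> - g (y \<tau>) \<bullet> z)) \<le> ?v"
    using minimax_affine[OF Y J, of "\<lambda>\<tau>. g (y \<tau>) \<bullet> y \<tau>" "\<lambda>\<tau>. g (y \<tau>)" ?v] by blast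
  have upper: "(\<Sum>\<tau>\<in>J. lam \<tau> * ?h \<tau> z) \<le> ?v" if "z \<in> Y" for z
    using lam(3)[OF that] by (simp add: lin_form_def inner_diff_right)
  have "?v = (\<Sum>\<tau>\<in>J. lam \<tau>) * (MIN \<tau>\<in>J. ?h \<tau> x)"
    using lam(2) x(2) by simp
  also have "\<dots> \<le> (\<Sum>\<tau>\<in>J. lam \<tau> * ?h \<tau> x)"
    unfolding sum_distrib_right using lam(1) J by (intro sum_mono mult_left_mono) auto
  finally have "(\<Sum>\<tau>\<in>J. lam \<tau> * ?h \<tau> x) = ?v"
    using upper[OF x(1)] by simp
  then have "(SUP z\<in>Y. \<Sum>\<tau>\<in>J. lam \<tau> * ?h \<tau> z) = ?v"
    using upper x(1) by (intro cSup_eq_maximum) (auto simp: image_iff intro: bexI[of _ x])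
  moreover have "(\<Sum>\<tau>\<in>J. (if \<tau> \<in> J then lam \<tau> else 0) * ?h \<tau> z) = (\<Sum>\<tau>\<in>J. lam \<tau> * ?h \<tau> z)" for z
    by (intro sum.cong) auto
  ultimately have "bundle_weights Y ?h t J (\<lambda>\<tau>. if \<tau> \<in> J then lam \<tau> else 0)"
    using lam(1,2) by (simp add: bundle_weights_def)
  then show ?thesis using that by blast
qed

lemma bundle_weights_upper:
  fixes Y :: "'a::euclidean_space set"
  assumes "compact Y" "bundle_weights Y (lin_form g y) t J lam" "z \<in> Y"
  shows "(\<Sum>\<tau>\<in>J. lam \<tau> * lin_form g y \<tau> z) \<le> bundle_gap Y (lin_form g y) J"
proof -
  have "continuous_on Y (\<lambda>z. \<Sum>\<tau>\<in>J. lam \<tau> * lin_form g y \<tau> z)"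
    by (intro continuous_intros lin_form_continuous)
  then have "bdd_above ((\<lambda>z. \<Sum>\<tau>\<in>J. lam \<tau> * lin_form g y \<tau> z) ` Y)"
    using assms(1) by (intro bounded_imp_bdd_above compact_imp_bounded compact_continuous_image)
  then show ?thesis
    using assms(2) cSUP_upper[OF assms(3)] unfolding bundle_weights_def by metis
qed

text \<open>
  Dropping the pieces of zero weight does not raise the gap: a minimum over the remaining pieces
  is at most their weighted mean, which already stays below the gap.
\<close>

lemma positive_weights_keep_gap:
  fixes Y :: "'a::euclidean_space set"
  assumes Y: "compact Y" and w: "bundle_weights Y (lin_form g y) t J lam" and J: "finite J" "J \<subseteq> {1..t}"
    and z: "z \<in> Y"
  shows "\<exists>\<tau>\<in>{\<tau>. 1 \<le> \<tau> \<and> \<tau> \<le> t \<and> 0 < lam \<tau>}. lin_form g y \<tau> z \<le> bundle_gap Y (lin_form g y) J"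
proof (rule ccontr)
  let ?v = "bundle_gap Y (lin_form g y) J"
  assume "\<not> ?thesis"
  then have gt: "?v < lin_form g y \<tau> z" if "\<tau> \<in> J" "0 < lam \<tau>" for \<tau>
    using that J(2) by force
  have nonneg: "\<And>\<tau>. \<tau> \<in> J \<Longrightarrow> 0 \<le> lam \<tau>" and one: "sum lam J = 1"
    using w by (auto simp: bundle_weights_def)
  obtain \<sigma> where \<sigma>: "\<sigma> \<in> J" "0 < lam \<sigma>"
    using one nonneg by (metis less_le sum.neutral zero_neq_one)
  have "?v = (\<Sum>\<tau>\<in>J. lam \<tau> * ?v)"
    by (simp add: sum_distrib_right[symmetric] one)
  also have "\<dots> < (\<Sum>\<tau>\<in>J. lam \<tau> * lin_form g y \<tau> z)"
  proof (rule sum_strict_mono_ex1[OF J(1)])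
    show "\<forall>\<tau>\<in>J. lam \<tau> * ?v \<le> lam \<tau> * lin_form g y \<tau> z"
      using gt nonneg by (metis less_le mult_left_mono mult_zero_left order_refl)
    show "\<exists>\<tau>\<in>J. lam \<tau> * ?v < lam \<tau> * lin_form g y \<tau> z"
      using mult_strict_left_mono[OF gt[OF \<sigma>] \<sigma>(2)] \<sigma>(1) by blast
  qed
  finally show False
    using bundle_weights_upper[OF Y w z] by simp
qed

section \<open>Prox-center and prox-steps\<close>

context prox_geometry
begin

lemma prox_center_minimizes:
  shows "prox_center Y \<omega> \<in> Y" "\<And>z. z \<in> Y \<Longrightarrow> \<omega> (prox_center Y \<omega>) \<le> \<omega> z"
proof -
  obtain x where "x \<in> Y" "\<And>z. z \<in> Y \<Longrightarrow> \<omega> x \<le> \<omega> z"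
    using continuous_attains_inf[OF Y_compact Y_nonempty \<omega>_continuous] by blast
  then have "is_arg_min \<omega> (\<lambda>z. z \<in> Y) x"
    by (auto simp: is_arg_min_def not_less)
  then have "is_arg_min \<omega> (\<lambda>z. z \<in> Y) (prox_center Y \<omega>)"
    unfolding prox_center_def arg_min_on_def arg_min_def by (rule someI)
  then show "prox_center Y \<omega> \<in> Y" "\<And>z. z \<in> Y \<Longrightarrow> \<omega> (prox_center Y \<omega>) \<le> \<omega> z"
    by (auto simp: is_arg_min_def not_less)
qed

lemma prox_center_in_dom: "prox_center Y \<omega> \<in> subdiff_dom Y \<omega>"
proof -
  have "0 \<in> subdiff Y \<omega> (prox_center Y \<omega>)"
    using prox_center_minimizes by (simp add: subdiff_def)
  then show ?thesis
    using prox_center_minimizes(1) by (auto simp: subdiff_dom_def)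
qed

text \<open>
  The selected subgradient at the prox-center need not vanish, but continuity of the selection
  forces it to satisfy the first-order optimality condition, so the linear term only helps.
\<close>

lemma bregman_prox_center_le:
  assumes "u \<in> Y"
  shows "bregman \<omega> \<omega>' u (prox_center Y \<omega>) \<le> (prox_width Y \<omega>)\<^sup>2 / 2"
proof -
  let ?c = "prox_center Y \<omega>"
  obtain w where "w \<in> rel_interior Y"
    using rel_interior_eq_empty[OF Y_convex] Y_nonempty by blast
  then have "0 \<le> (\<omega>' ?c - 0) \<bullet> (u - ?c)"
    using prox_center_minimizes rel_interior_subset assms
    by (intro variational_inequality[OF prox_center_in_dom Y_convex, of w]) auto
  then have "bregman \<omega> \<omega>' u ?c \<le> \<omega> u - \<omega> ?c"
    by (simp add: bregman_def)
  also have "\<dots> \<le> (SUP y\<in>Y. \<omega> y) - (INF y\<in>Y. \<omega> y)"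
  proof -
    have "bounded (\<omega> ` Y)"
      by (intro compact_imp_bounded compact_continuous_image \<omega>_continuous Y_compact)
    then show ?thesis
      using assms prox_center_minimizes(1)
      by (intro diff_mono cSUP_upper cINF_lower bounded_imp_bdd_above bounded_imp_bdd_below)
  qed
  finally have le: "bregman \<omega> \<omega>' u ?c \<le> (SUP y\<in>Y. \<omega> y) - (INF y\<in>Y. \<omega> y)" .
  moreover have "0 \<le> bregman \<omega> \<omega>' u ?c"
    using bregman_strong_convexity[OF prox_center_in_dom assms] by (smt (verit) zero_le_power2 divide_nonneg_pos)
  ultimately show ?thesis
    by (simp add: prox_width_def)
qed

lemma bregman_nonneg:
  assumes "y \<in> subdiff_dom Y \<omega>" "z \<in> Y"
  shows "0 \<le> bregman \<omega> \<omega>' z y"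
  using subgradient_ineq[OF assms] by (simp add: bregman_def)

end

lemma level_set_convex:
  fixes Y :: "'a::euclidean_space set"
  assumes "convex Y"
  shows "convex (level_set Y (lin_form g y) J l)"
proof -
  have "level_set Y (lin_form g y) J l =
      Y \<inter> (\<Inter>\<tau>\<in>J. {z. g (y \<tau>) \<bullet> z \<le> g (y \<tau>) \<bullet> y \<tau> - l})"
    by (auto simp: level_set_def lin_form_def inner_diff_right algebra_simps)
  then show ?thesis
    using assms by (simp add: convex_Int convex_INT convex_halfspace_le)
qed

lemma level_set_compact:
  fixes Y :: "'a::euclidean_space set"
  assumes "compact Y"
  shows "compact (level_set Y (lin_form g y) J l)"
proof -
  have "level_set Y (lin_form g y) J l =
      Y \<inter> (\<Inter>\<tau>\<in>J. {z. g (y \<tau>) \<bullet> z \<le> g (y \<tau>) \<bullet> y \<tau> - l})"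
    by (auto simp: level_set_def lin_form_def inner_diff_right algebra_simps)
  then show ?thesis
    using assms by (simp add: compact_Int_closed closed_INT closed_halfspace_le)
qed

text \<open>
  The strictly feasible point plays the role of a Slater point: nearby relatively interior points
  of \<open>Y\<close> remain feasible.
\<close>

locale strict_level_set = prox_geometry Y nrm \<omega> \<omega>'
  for Y :: "'a::euclidean_space set" and nrm \<omega> :: "'a \<Rightarrow> real" and \<omega>' :: "'a \<Rightarrow> 'a" +
  fixes g :: "'a \<Rightarrow> 'a" and y :: "nat \<Rightarrow> 'a" and J :: "nat set" and l :: real and z\<^sub>0 :: 'a
  assumes J_finite: "finite J" and z\<^sub>0: "z\<^sub>0 \<in> Y"
    and strict: "\<And>\<tau>. \<tau> \<in> J \<Longrightarrow> l < lin_form g y \<tau> z\<^sub>0"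
begin

abbreviation "U \<equiv> level_set Y (lin_form g y) J l"

lemma U_subset: "U \<subseteq> Y"
  by (auto simp: level_set_def)

lemma slater_point:
  obtains w where "w \<in> U" "w \<in> rel_interior Y"
    "w \<in> rel_interior {z. \<forall>\<tau>\<in>J. l \<le> lin_form g y \<tau> z}"
proof -
  define G where "G = (\<Inter>\<tau>\<in>J. {z. l < lin_form g y \<tau> z})"
  have "open G"
    unfolding G_def
    by (intro open_INT J_finite ballI open_Collect_less lin_form_continuous continuous_intros)
  moreover have "z\<^sub>0 \<in> G"
    using strict by (simp add: G_def)
  ultimately obtain w where w: "w \<in> rel_interior Y" "w \<in> G"
    using open_meets_rel_interior[OF Y_convex _ z\<^sub>0] by blast
  have "G \<subseteq> {z. \<forall>\<tau>\<in>J. l \<le> lin_form g y \<tau> z}"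
    by (auto simp: G_def intro: less_imp_le)
  then have "w \<in> interior {z. \<forall>\<tau>\<in>J. l \<le> lin_form g y \<tau> z}"
    using w(2) \<open>open G\<close> by (meson interiorI)
  then have "w \<in> rel_interior {z. \<forall>\<tau>\<in>J. l \<le> lin_form g y \<tau> z}"
    using interior_subset_rel_interior by blast
  moreover have "w \<in> U"
    using w rel_interior_subset by (fastforce simp: level_set_def G_def intro: less_imp_le)
  ultimately show ?thesis
    using w that by blast
qed

lemma prox_step_exists:
  assumes "yhat \<in> subdiff_dom Y \<omega>"
  obtains x where "prox_step Y \<omega> \<omega>' U yhat x"
proof -
  have "continuous_on U (\<lambda>z. \<omega> z - \<omega>' yhat \<bullet> z)"
    using continuous_on_subset[OF \<omega>_continuous U_subset] by (intro continuous_intros)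
  moreover have "U \<noteq> {}"
    using slater_point by blast
  ultimately obtain x where "x \<in> U"
    "\<And>z. z \<in> U \<Longrightarrow> \<omega> x - \<omega>' yhat \<bullet> x \<le> \<omega> z - \<omega>' yhat \<bullet> z"
    using continuous_attains_inf[OF level_set_compact[OF Y_compact]] by blast
  then have "prox_step Y \<omega> \<omega>' U yhat x"
    using assms by (auto simp: prox_step_def is_arg_min_def not_less)
  then show ?thesis using that by blast
qed

lemma prox_step_minimizes:
  assumes "prox_step Y \<omega> \<omega>' U yhat x"
  shows "yhat \<in> subdiff_dom Y \<omega>" "x \<in> U"
    "\<And>z. z \<in> U \<Longrightarrow> \<omega> x - \<omega>' yhat \<bullet> x \<le> \<omega> z - \<omega>' yhat \<bullet> z"
  using assms by (auto simp: prox_step_def is_arg_min_def not_less)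

text \<open>
  The new point may lie on the relative boundary of \<open>Y\<close>; the strict point is what provides a
  subgradient there.
\<close>

lemma prox_step_in_dom:
  assumes "prox_step Y \<omega> \<omega>' U yhat x"
  shows "x \<in> subdiff_dom Y \<omega>"
proof -
  let ?P = "{z. \<forall>\<tau>\<in>J. l \<le> lin_form g y \<tau> z}"
  note min = prox_step_minimizes[OF assms]
  have P: "?P = level_set UNIV (lin_form g y) J l"
    by (auto simp: level_set_def)
  obtain w where "w \<in> rel_interior Y" "w \<in> rel_interior ?P"
    using slater_point by blast
  then have "x \<in> subdiff_dom Y (\<lambda>z. \<omega> z - \<omega>' yhat \<bullet> z)"
  proof (rule constrained_minimizer_in_subdiff_dom[OF Y_convex _ convex_on_minus_linear[OF \<omega>_convex], rotated 4])
    show "convex ?P"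
      unfolding P by (rule level_set_convex) simp
  qed (use min in \<open>auto simp: level_set_def\<close>)
  then show ?thesis
    by (simp add: subdiff_dom_minus_linear)
qed

lemma prox_step_three_point:
  assumes ps: "prox_step Y \<omega> \<omega>' U yhat x" and u: "u \<in> U"
  shows "bregman \<omega> \<omega>' u x + bregman \<omega> \<omega>' x yhat \<le> bregman \<omega> \<omega>' u yhat"
proof -
  note min = prox_step_minimizes[OF ps]
  obtain w where "w \<in> U" "w \<in> rel_interior Y"
    using slater_point by blast
  then have "0 \<le> (\<omega>' x - \<omega>' yhat) \<bullet> (u - x)"
    by (rule variational_inequality[OF prox_step_in_dom[OF ps] level_set_convex[OF Y_convex] U_subset min(2) _ _ min(3) u])
  then show ?thesis
    by (simp add: bregman_def algebra_simps)
qed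

text \<open>
  The linear form attached to \<open>y \<sigma>\<close>, where the step starts, vanishes there and is at least \<open>l\<close> at the new
  point, so the step has length at least \<open>l / L\<close>. The inequality is multiplied by \<open>L\<^sup>2\<close>, which
  covers \<open>L = 0\<close>.
\<close>

lemma prox_step_decrease:
  assumes ps: "prox_step Y \<omega> \<omega>' U (y \<sigma>) x" and u: "u \<in> U" and \<sigma>: "\<sigma> \<in> J" and l: "0 \<le> l"
    and L: "dual_norm nrm (g (y \<sigma>)) \<le> L"
  shows "L\<^sup>2 * bregman \<omega> \<omega>' u x + l\<^sup>2 / 2 \<le> L\<^sup>2 * bregman \<omega> \<omega>' u (y \<sigma>)"
proof -
  note min = prox_step_minimizes[OF ps]
  have "l \<le> g (y \<sigma>) \<bullet> (y \<sigma> - x)"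
    using min(2) \<sigma> by (simp add: level_set_def lin_form_def)
  also have "\<dots> \<le> dual_norm nrm (g (y \<sigma>)) * nrm (y \<sigma> - x)"
    by (rule inner_le_dual_norm[OF norm_ax])
  also have "\<dots> \<le> L * nrm (y \<sigma> - x)"
    by (intro mult_right_mono L is_norm_nonneg[OF norm_ax])
  also have "nrm (y \<sigma> - x) = nrm (x - y \<sigma>)"
  proof -
    have "nrm ((-1) *\<^sub>R (x - y \<sigma>)) = \<bar>-1\<bar> * nrm (x - y \<sigma>)"
      using norm_ax unfolding is_norm_def by blast
    then show ?thesis by simp
  qed
  finally have "l\<^sup>2 \<le> (L * nrm (x - y \<sigma>))\<^sup>2"
    using l by (intro power_mono)
  also have "\<dots> \<le> L\<^sup>2 * (2 * bregman \<omega> \<omega>' x (y \<sigma>))"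
    using bregman_strong_convexity[OF min(1)] min(2) U_subset
    unfolding power_mult_distrib by (intro mult_left_mono) force+
  finally have "l\<^sup>2 / 2 \<le> L\<^sup>2 * bregman \<omega> \<omega>' x (y \<sigma>)" by simp
  moreover have "L\<^sup>2 * (bregman \<omega> \<omega>' u x + bregman \<omega> \<omega>' x (y \<sigma>)) \<le> L\<^sup>2 * bregman \<omega> \<omega>' u (y \<sigma>)"
    by (intro mult_left_mono prox_step_three_point[OF ps u]) simp
  ultimately show ?thesis
    by (simp add: distrib_left)
qed

end

section \<open>The potential along a run\<close>

lemma lin_form_fun_upd:
  "\<tau> \<noteq> t \<Longrightarrow> lin_form g (y(t := x)) \<tau> = lin_form g y \<tau>"
  by (simp add: lin_form_def fun_eq_iff)

locale mirror_descent_level = prox_geometry Y nrm \<omega> \<omega>'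
  for Y :: "'a::euclidean_space set" and nrm \<omega> :: "'a \<Rightarrow> real" and \<omega>' :: "'a \<Rightarrow> 'a" +
  fixes g :: "'a \<Rightarrow> 'a" and L \<epsilon> \<gamma> :: real
  assumes g_bound: "\<And>x. x \<in> Y \<Longrightarrow> dual_norm nrm (g x) \<le> L"
    and \<epsilon>_pos: "0 < \<epsilon>" and \<gamma>_pos: "0 < \<gamma>" and \<gamma>_less_1: "\<gamma> < 1"
begin

abbreviation "center \<equiv> prox_center Y \<omega>"
abbreviation "step \<equiv> mdl_step Y \<omega> \<omega>' g \<epsilon> \<gamma>"

definition budget :: real where
  "budget = L\<^sup>2 * (prox_width Y \<omega>)\<^sup>2"

text \<open>
  The state of a phase with initial gap \<open>\<delta>\<close> after \<open>n\<close> steps of the run, \<open>m\<close> of them in the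
  phase. The bound on the bundle keeps all later gaps of the phase at most \<open>\<delta>\<close>, so that the points
  of level \<open>\<gamma> * \<delta>\<close> belong to every level set that the phase projects on. Each step of the phase
  has used up at least \<open>\<gamma> ^ 4 * \<delta>\<^sup>2 / 2\<close> of the scaled Bregman distance to these points, and there
  is such a point, which bounds \<open>m\<close>. The last condition sums up the earlier phases, whose gaps
  are at least \<open>\<delta> / \<gamma>\<close>, \<open>\<delta> / \<gamma>\<^sup>2\<close>, and so on, backwards from the current one: a geometric series
  of ratio \<open>\<gamma>\<^sup>2\<close>.
\<close>

definition phase_invariant ::
  "nat \<Rightarrow> (nat \<Rightarrow> 'a) \<Rightarrow> nat set \<Rightarrow> real \<Rightarrow> nat \<Rightarrow> bool" where
  "phase_invariant n y I \<delta> m \<longleftrightarrow>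
     \<epsilon> < \<delta> \<and> m \<le> n \<and>
     (\<forall>z\<in>Y. \<exists>\<tau>\<in>I. lin_form g y \<tau> z \<le> \<delta>) \<and>
     level_set Y (lin_form g y) I (\<gamma> * \<delta>) \<noteq> {} \<and>
     (\<forall>u\<in>level_set Y (lin_form g y) I (\<gamma> * \<delta>).
        L\<^sup>2 * bregman \<omega> \<omega>' u (y (Suc n)) + real m * (\<gamma> ^ 4 * \<delta>\<^sup>2) / 2 \<le> budget / 2) \<and>
     real (n - m) * (\<gamma> ^ 4 * (1 - \<gamma>\<^sup>2) * \<delta>\<^sup>2) \<le> \<gamma>\<^sup>2 * budget"

fun invariant :: "nat \<Rightarrow> 'a mdl_config \<Rightarrow> bool" where
  "invariant n (At_Step t y I k \<Delta>) \<longleftrightarrow>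
     t = Suc n \<and> (\<forall>\<tau>\<in>{1..t}. y \<tau> \<in> Y) \<and> y 1 = center \<and> y t \<in> subdiff_dom Y \<omega> \<and> I \<subseteq> {1..n} \<and>
     (if n = 0 then \<Delta> k = \<infinity>
      else 1 \<in> I \<and> (\<exists>\<delta> m. \<Delta> k = ereal \<delta> \<and> phase_invariant n y I \<delta> m))"
| "invariant n (Finished t P lam) \<longleftrightarrow>
     t = n \<and> real n \<le> budget / (\<gamma> ^ 4 * (1 - \<gamma>\<^sup>2) * \<epsilon>\<^sup>2) + 1 \<and>
     (\<forall>\<tau>\<in>{1..t}. fst (P \<tau>) \<in> Y \<and> snd (P \<tau>) = g (fst (P \<tau>)) \<and> 0 \<le> lam \<tau>) \<and>
     (\<Sum>\<tau>=1..t. lam \<tau>) = 1 \<and> residual Y t P lam \<le> \<epsilon>"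

lemma budget_nonneg: "0 \<le> budget"
  by (simp add: budget_def)

lemma one_minus_\<gamma>_pos: "0 < 1 - \<gamma>\<^sup>2"
  using \<gamma>_pos \<gamma>_less_1 by (simp add: power_less_one_iff)

text \<open>
  Multiplied by \<open>1 - \<gamma>\<^sup>2\<close>, the bound on the steps of the current phase takes the share \<open>1 - \<gamma>\<^sup>2\<close> of
  the budget; the earlier phases take the share \<open>\<gamma>\<^sup>2\<close>.
\<close>

lemma steps_times_gap_le_budget:
  assumes inv: "phase_invariant n y I \<delta> m" and dom: "y (Suc n) \<in> subdiff_dom Y \<omega>"
  shows "real n * (\<gamma> ^ 4 * (1 - \<gamma>\<^sup>2) * \<delta>\<^sup>2) \<le> budget"
proof -
  obtain u where u: "u \<in> level_set Y (lin_form g y) I (\<gamma> * \<delta>)"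
    using inv by (auto simp: phase_invariant_def)
  then have "0 \<le> L\<^sup>2 * bregman \<omega> \<omega>' u (y (Suc n))"
    using bregman_nonneg[OF dom, of u] by (simp add: level_set_def)
  moreover have "L\<^sup>2 * bregman \<omega> \<omega>' u (y (Suc n)) + real m * (\<gamma> ^ 4 * \<delta>\<^sup>2) / 2 \<le> budget / 2"
    using inv u by (simp add: phase_invariant_def)
  ultimately have "real m * (\<gamma> ^ 4 * \<delta>\<^sup>2) \<le> budget" by simp
  then have "(1 - \<gamma>\<^sup>2) * (real m * (\<gamma> ^ 4 * \<delta>\<^sup>2)) \<le> (1 - \<gamma>\<^sup>2) * budget"
    using one_minus_\<gamma>_pos by (intro mult_left_mono) auto
  moreover have "m \<le> n" "real (n - m) * (\<gamma> ^ 4 * (1 - \<gamma>\<^sup>2) * \<delta>\<^sup>2) \<le> \<gamma>\<^sup>2 * budget"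
    using inv by (auto simp: phase_invariant_def)
  ultimately show ?thesis
    by (simp add: of_nat_diff algebra_simps)
qed

lemma invariant_steps_le:
  assumes "invariant n (At_Step t y I k \<Delta>)"
  shows "real n \<le> budget / (\<gamma> ^ 4 * (1 - \<gamma>\<^sup>2) * \<epsilon>\<^sup>2)"
proof (cases "n = 0")
  case True
  then show ?thesis
    using budget_nonneg one_minus_\<gamma>_pos by simp
next
  case False
  then obtain \<delta> m where inv: "phase_invariant n y I \<delta> m" and dom: "y (Suc n) \<in> subdiff_dom Y \<omega>"
    using assms by auto
  have "\<epsilon>\<^sup>2 \<le> \<delta>\<^sup>2"
    using inv \<epsilon>_pos by (intro power_mono) (auto simp: phase_invariant_def)
  then have "real n * (\<gamma> ^ 4 * (1 - \<gamma>\<^sup>2) * \<epsilon>\<^sup>2) \<le> real n * (\<gamma> ^ 4 * (1 - \<gamma>\<^sup>2) * \<delta>\<^sup>2)"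
    using one_minus_\<gamma>_pos by (intro mult_left_mono) auto
  also have "\<dots> \<le> budget"
    by (rule steps_times_gap_le_budget[OF inv dom])
  finally show ?thesis
    using one_minus_\<gamma>_pos \<epsilon>_pos \<gamma>_pos by (simp add: pos_le_divide_eq)
qed

lemma start_invariant: "invariant 0 (mdl_start Y \<omega>)"
  using prox_center_minimizes(1) prox_center_in_dom by (auto simp: mdl_start_def)

lemma invariant_index_set:
  assumes "invariant n (At_Step t y I k \<Delta>)"
  shows "t = Suc n" "finite (insert t I)" "insert t I \<subseteq> {1..t}" "1 \<in> insert t I"
proof -
  show t: "t = Suc n" and sub: "insert t I \<subseteq> {1..t}"
    using assms by auto
  show "finite (insert t I)"
    using finite_subset[OF sub] by simp
  show "1 \<in> insert t I"
    using assms by (cases "n = 0") auto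
qed

lemma gap_witness:
  assumes "finite J" "J \<noteq> {}"
  obtains z where "z \<in> Y" "\<And>\<tau>. \<tau> \<in> J \<Longrightarrow> bundle_gap Y (lin_form g y) J \<le> lin_form g y \<tau> z"
proof -
  obtain z where z: "z \<in> Y" "bundle_gap Y (lin_form g y) J = (MIN \<tau>\<in>J. lin_form g y \<tau> z)"
  proof (rule bundle_gap_attained[OF Y_compact Y_nonempty assms])
    show "continuous_on Y (lin_form g y \<tau>)" for \<tau>
      by (rule lin_form_continuous)
  qed
  have "bundle_gap Y (lin_form g y) J \<le> lin_form g y \<tau> z" if "\<tau> \<in> J" for \<tau>
    unfolding z(2) using that assms by simp
  then show ?thesis
    using z(1) that by blast
qed

text \<open>
  The level \<open>\<gamma>\<close> times the gap lies strictly below the gap, so a point that attains the gap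
  satisfies all inequalities strictly.
\<close>

lemma strict_level_setI:
  assumes "finite J" "J \<noteq> {}" "J' \<subseteq> J" "\<epsilon> < bundle_gap Y (lin_form g y) J"
  obtains z where "strict_level_set Y nrm \<omega> \<omega>' g y J' (\<gamma> * bundle_gap Y (lin_form g y) J) z"
proof -
  let ?v = "bundle_gap Y (lin_form g y) J"
  obtain z where z: "z \<in> Y" "\<And>\<tau>. \<tau> \<in> J \<Longrightarrow> ?v \<le> lin_form g y \<tau> z"
    using gap_witness[OF assms(1,2)] by metis
  have "\<gamma> * ?v < ?v"
    using assms(4) \<epsilon>_pos \<gamma>_less_1 by simp
  then have "strict_level_set Y nrm \<omega> \<omega>' g y J' (\<gamma> * ?v) z"
    using z assms(3) finite_subset[OF assms(3,1)]
    by unfold_locales (auto intro: less_le_trans)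
  then show ?thesis using that by blast
qed

lemma new_phase_index_set:
  assumes "bundle_weights Y h t J lam" "J \<subseteq> {1..t}" "1 \<in> J"
  shows "{\<tau>. 1 \<le> \<tau> \<and> \<tau> \<le> t \<and> 0 < lam \<tau>} \<union> {1} \<subseteq> J"
proof
  fix \<tau> assume \<tau>: "\<tau> \<in> {\<tau>. 1 \<le> \<tau> \<and> \<tau> \<le> t \<and> 0 < lam \<tau>} \<union> {1}"
  show "\<tau> \<in> J"
  proof (rule ccontr)
    assume "\<tau> \<notin> J"
    then have "\<tau> \<in> {1..t} - J" "0 < lam \<tau>"
      using \<tau> assms(3) by auto
    then show False
      using assms(1) unfolding bundle_weights_def by (metis less_irrefl)
  qed
qed

text \<open>
  The weights vanish off the bundle, so the residual of the output is the last gap.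
\<close>

lemma invariant_terminate:
  assumes inv: "invariant n (At_Step t y I k \<Delta>)"
    and w: "bundle_weights Y (lin_form g y) t (insert t I) lam"
    and gap: "bundle_gap Y (lin_form g y) (insert t I) \<le> \<epsilon>"
  shows "invariant (Suc n) (Finished t (\<lambda>\<tau>. (y \<tau>, g (y \<tau>))) lam)"
proof -
  note idx = invariant_index_set[OF inv]
  let ?J = "insert t I"
  have zero: "lam \<tau> = 0" if "\<tau> \<in> {1..t} - ?J" for \<tau>
    using w that unfolding bundle_weights_def by blast
  have extend: "(\<Sum>\<tau>=1..t. lam \<tau> * f \<tau>) = (\<Sum>\<tau>\<in>?J. lam \<tau> * f \<tau>)" for f
    by (rule sum.mono_neutral_right) (use idx zero in auto)
  have "residual Y t (\<lambda>\<tau>. (y \<tau>, g (y \<tau>))) lam = bundle_gap Y (lin_form g y) ?J"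
    using w unfolding residual_def fst_conv snd_conv extend bundle_weights_def lin_form_def
    by simp
  moreover have "(\<Sum>\<tau>=1..t. lam \<tau>) = 1"
    using extend[of "\<lambda>_. 1"] w by (simp add: bundle_weights_def)
  moreover have "0 \<le> lam \<tau>" if "\<tau> \<in> {1..t}" for \<tau>
    using w zero that unfolding bundle_weights_def by (metis DiffI order_refl)
  ultimately show ?thesis
    using inv gap idx(1) invariant_steps_le[OF inv] by auto
qed

text \<open>
  A new phase restarts from the prox-center, where the Bregman distance to any point of \<open>Y\<close> is at
  most half the squared width. The first search point is the prox-center too, and its index is kept
  in the bundle, so already the first step of the phase has the guaranteed length. The previous
  phase moves into the geometric sum because its gap was at least \<open>\<delta> / \<gamma>\<close>.
\<close>

lemma invariant_new_phase:
  assumes inv: "invariant n (At_Step t y I k \<Delta>)"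
    and w: "bundle_weights Y (lin_form g y) t (insert t I) lam"
    and \<delta>: "\<delta> = bundle_gap Y (lin_form g y) (insert t I)" "\<epsilon> < \<delta>" "ereal \<delta> \<le> ereal \<gamma> * \<Delta> k"
    and J: "J = {\<tau>. 1 \<le> \<tau> \<and> \<tau> \<le> t \<and> 0 < lam \<tau>} \<union> {1}"
    and ps: "prox_step Y \<omega> \<omega>' (level_set Y (lin_form g y) J (\<gamma> * \<delta>)) center x"
  shows "invariant (Suc n) (At_Step (Suc t) (y(Suc t := x)) J (Suc k) (\<Delta>(Suc k := ereal \<delta>)))"
proof -
  note idx = invariant_index_set[OF inv]
  let ?I = "insert t I" and ?y = "y(Suc t := x)"
  have JI: "J \<subseteq> ?I"
    unfolding J by (rule new_phase_index_set[OF w idx(3,4)])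
  obtain z where "strict_level_set Y nrm \<omega> \<omega>' g y J (\<gamma> * \<delta>) z"
    using strict_level_setI[OF idx(2) _ JI] \<delta>(1,2) by blast
  then interpret strict_level_set Y nrm \<omega> \<omega>' g y J "\<gamma> * \<delta>" z .
  have x: "x \<in> subdiff_dom Y \<omega>" "x \<in> Y"
    using prox_step_in_dom[OF ps] by (auto simp: subdiff_dom_def)
  have y1: "y 1 = center" using inv by simp
  have same: "lin_form g ?y \<tau> = lin_form g y \<tau>" if "\<tau> \<in> J" for \<tau>
    using that JI idx(3) by (intro lin_form_fun_upd) force
  then have level: "level_set Y (lin_form g ?y) J l = level_set Y (lin_form g y) J l" for l
    by (auto simp: level_set_def)
  have y_new: "?y (Suc (Suc n)) = x"
    using idx(1) by simp
  have pos: "0 < \<delta>" using \<delta>(2) \<epsilon>_pos by simp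
  have "\<exists>\<tau>\<in>J. lin_form g ?y \<tau> v \<le> \<delta>" if "v \<in> Y" for v
    using positive_weights_keep_gap[OF Y_compact w idx(2,3) that] same unfolding \<delta>(1) J
    by fastforce
  moreover have "L\<^sup>2 * bregman \<omega> \<omega>' u x + \<gamma> ^ 4 * \<delta>\<^sup>2 / 2 \<le> budget / 2" if "u \<in> U" for u
  proof -
    have "L\<^sup>2 * bregman \<omega> \<omega>' u x + (\<gamma> * \<delta>)\<^sup>2 / 2 \<le> L\<^sup>2 * bregman \<omega> \<omega>' u center"
      using prox_step_decrease[of 1 x u L] ps y1 that pos \<gamma>_pos g_bound prox_center_minimizes(1)
      by (simp add: J)
    also have "\<dots> \<le> L\<^sup>2 * ((prox_width Y \<omega>)\<^sup>2 / 2)"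
      using that U_subset by (intro mult_left_mono bregman_prox_center_le) auto
    finally have "L\<^sup>2 * bregman \<omega> \<omega>' u x + (\<gamma> * \<delta>)\<^sup>2 / 2 \<le> budget / 2"
      by (simp add: budget_def)
    moreover have "\<gamma> ^ 4 \<le> \<gamma>\<^sup>2"
      using \<gamma>_pos \<gamma>_less_1 by (intro power_decreasing) auto
    then have "\<gamma> ^ 4 * \<delta>\<^sup>2 \<le> (\<gamma> * \<delta>)\<^sup>2"
      by (simp add: power_mult_distrib mult_right_mono)
    ultimately show ?thesis by linarith
  qed
  moreover have "real n * (\<gamma> ^ 4 * (1 - \<gamma>\<^sup>2) * \<delta>\<^sup>2) \<le> \<gamma>\<^sup>2 * budget"
  proof (cases "n = 0")
    case True
    then show ?thesis using budget_nonneg by simp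
  next
    case False
    then obtain \<delta>' m where prev: "\<Delta> k = ereal \<delta>'" "phase_invariant n y I \<delta>' m"
      using inv by auto
    have "\<delta> \<le> \<gamma> * \<delta>'"
      using \<delta>(3) prev(1) by simp
    then have "\<delta>\<^sup>2 \<le> (\<gamma> * \<delta>')\<^sup>2"
      using pos by (intro power_mono) auto
    then have "real n * (\<gamma> ^ 4 * (1 - \<gamma>\<^sup>2) * \<delta>\<^sup>2) \<le> real n * (\<gamma> ^ 4 * (1 - \<gamma>\<^sup>2) * (\<gamma> * \<delta>')\<^sup>2)"
      using one_minus_\<gamma>_pos by (intro mult_left_mono) auto
    also have "\<dots> = \<gamma>\<^sup>2 * (real n * (\<gamma> ^ 4 * (1 - \<gamma>\<^sup>2) * \<delta>'\<^sup>2))"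
      by (simp add: power_mult_distrib)
    also have "\<dots> \<le> \<gamma>\<^sup>2 * budget"
      using steps_times_gap_le_budget[OF prev(2)] inv by (intro mult_left_mono) auto
    finally show ?thesis .
  qed
  moreover have "U \<noteq> {}"
    using slater_point by blast
  ultimately have "phase_invariant (Suc n) ?y J \<delta> 1"
    using \<delta>(2) unfolding phase_invariant_def level y_new by simp
  then show ?thesis
    using inv x JI idx y1 J by auto
qed

text \<open>
  The gap \<open>v\<close> lies between \<open>\<gamma> * \<delta>\<close> and \<open>\<delta>\<close>. The lower bound makes the step long enough and keeps
  a point that attains \<open>v\<close> in the level set at \<open>\<gamma> * \<delta>\<close>; the upper bound keeps the points of level
  \<open>\<gamma> * \<delta>\<close> inside the set that the step projects on.
\<close>

lemma invariant_same_phase: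
  assumes inv: "invariant n (At_Step t y I k \<Delta>)"
    and gap: "v = bundle_gap Y (lin_form g y) (insert t I)" "\<epsilon> < v" "\<not> ereal v \<le> ereal \<gamma> * \<Delta> k"
    and ps: "prox_step Y \<omega> \<omega>' (level_set Y (lin_form g y) (insert t I) (\<gamma> * v)) (y t) x"
  shows "invariant (Suc n) (At_Step (Suc t) (y(Suc t := x)) (insert t I) k \<Delta>)"
proof -
  note idx = invariant_index_set[OF inv]
  let ?I = "insert t I" and ?y = "y(Suc t := x)"
  \<comment> \<open>The first step has infinite reference gap and hence always opens a phase.\<close>
  have n: "n \<noteq> 0"
    using inv gap(3) \<gamma>_pos by (auto split: if_splits)
  then obtain \<delta> m where \<Delta>: "\<Delta> k = ereal \<delta>" and ph: "phase_invariant n y I \<delta> m"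
    using inv by auto
  obtain z where "strict_level_set Y nrm \<omega> \<omega>' g y ?I (\<gamma> * v) z"
    using strict_level_setI[OF idx(2) _ order_refl] gap(1,2) by blast
  then interpret strict_level_set Y nrm \<omega> \<omega>' g y ?I "\<gamma> * v" z .
  have x: "x \<in> subdiff_dom Y \<omega>" "x \<in> Y"
    using prox_step_in_dom[OF ps] by (auto simp: subdiff_dom_def)
  have same: "lin_form g ?y \<tau> = lin_form g y \<tau>" if "\<tau> \<in> ?I" for \<tau>
    using that idx(3) by (intro lin_form_fun_upd) force
  then have level: "level_set Y (lin_form g ?y) ?I l = level_set Y (lin_form g y) ?I l" for l
    by (auto simp: level_set_def)
  have y_new: "?y (Suc (Suc n)) = x"
    using idx(1) by simp
  have pos: "0 < v" "0 < \<delta>"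
    using gap(2) ph \<epsilon>_pos by (auto simp: phase_invariant_def)
  have big: "\<gamma> * \<delta> < v"
    using gap(3) \<Delta> by simp
  obtain u0 where u0: "u0 \<in> Y" "\<And>\<tau>. \<tau> \<in> ?I \<Longrightarrow> v \<le> lin_form g y \<tau> u0"
    using gap_witness[OF idx(2)] unfolding gap(1) by blast
  have ne: "level_set Y (lin_form g y) ?I (\<gamma> * \<delta>) \<noteq> {}"
    using u0 big unfolding level_set_def by fastforce
  have small: "v \<le> \<delta>"
    using ph u0 unfolding phase_invariant_def by (meson insertI2 order_trans)
  have "\<exists>\<tau>\<in>?I. lin_form g ?y \<tau> z \<le> \<delta>" if "z \<in> Y" for z
    using ph that same unfolding phase_invariant_def by fastforce
  moreover have "L\<^sup>2 * bregman \<omega> \<omega>' u x + real (Suc m) * (\<gamma> ^ 4 * \<delta>\<^sup>2) / 2 \<le> budget / 2"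
    if u: "u \<in> level_set Y (lin_form g y) ?I (\<gamma> * \<delta>)" for u
  proof -
    have "\<gamma> * v \<le> \<gamma> * \<delta>"
      using small \<gamma>_pos by simp
    then have "u \<in> U"
      using u by (force simp: level_set_def)
    moreover have "y t \<in> Y"
      using inv by simp
    ultimately have "L\<^sup>2 * bregman \<omega> \<omega>' u x + (\<gamma> * v)\<^sup>2 / 2 \<le> L\<^sup>2 * bregman \<omega> \<omega>' u (y t)"
      using prox_step_decrease[of t x u L] ps pos \<gamma>_pos g_bound by simp
    moreover have "L\<^sup>2 * bregman \<omega> \<omega>' u (y t) + real m * (\<gamma> ^ 4 * \<delta>\<^sup>2) / 2 \<le> budget / 2"
      using ph u idx(1) by (simp add: phase_invariant_def level_set_def)
    moreover have "(\<gamma> * (\<gamma> * \<delta>))\<^sup>2 \<le> (\<gamma> * v)\<^sup>2"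
      using big pos \<gamma>_pos by (intro power_mono mult_left_mono) auto
    then have "\<gamma> ^ 4 * \<delta>\<^sup>2 \<le> (\<gamma> * v)\<^sup>2"
      by (simp add: power_mult_distrib power2_eq_square power4_eq_xxxx mult_ac)
    ultimately show ?thesis
      by (simp add: distrib_right add_divide_distrib)
  qed
  ultimately have "phase_invariant (Suc n) ?y ?I \<delta> (Suc m)"
    using ph ne unfolding phase_invariant_def level y_new diff_Suc_Suc by blast
  then show ?thesis
    using inv x idx n \<Delta> by auto
qed

lemma step_invariant:
  assumes inv: "invariant n c" and step: "step c c'"
  shows "invariant (Suc n) c'"
  using step
proof cases
  case terminate
  then show ?thesis using invariant_terminate inv by blast
next
  case new_phase
  then show ?thesis using invariant_new_phase inv by blast
next
  case same_phase
  then show ?thesis using invariant_same_phase inv by blast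
qed

lemma run_invariant:
  assumes "(step ^^ n) (mdl_start Y \<omega>) c"
  shows "invariant n c"
  using assms
proof (induction n arbitrary: c)
  case 0
  then show ?case using start_invariant by simp
next
  case (Suc n)
  then obtain b where "(step ^^ n) (mdl_start Y \<omega>) b" "step b c"
    by (auto elim: relpowp_Suc_E)
  then show ?case
    using Suc.IH step_invariant by blast
qed

lemma run_steps_le:
  assumes "invariant n c"
  shows "real n \<le> 2 * (prox_width Y \<omega>)\<^sup>2 * L\<^sup>2 / (\<gamma> ^ 4 * (1 - \<gamma>\<^sup>2) * \<epsilon>\<^sup>2) + 1"
proof -
  let ?B = "budget / (\<gamma> ^ 4 * (1 - \<gamma>\<^sup>2) * \<epsilon>\<^sup>2)"
  have "real n \<le> ?B + 1"
    using assms invariant_steps_le by (cases c) fastforce+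
  moreover have "0 \<le> ?B"
    using budget_nonneg one_minus_\<gamma>_pos by simp
  moreover have "2 * (prox_width Y \<omega>)\<^sup>2 * L\<^sup>2 / (\<gamma> ^ 4 * (1 - \<gamma>\<^sup>2) * \<epsilon>\<^sup>2) = 2 * ?B"
    by (simp add: budget_def)
  ultimately show ?thesis by linarith
qed

lemma step_possible:
  assumes inv: "invariant n (At_Step t y I k \<Delta>)"
  shows "\<exists>c'. step (At_Step t y I k \<Delta>) c'"
proof -
  note idx = invariant_index_set[OF inv]
  let ?J = "insert t I"
  let ?v = "bundle_gap Y (lin_form g y) ?J"
  obtain lam where w: "bundle_weights Y (lin_form g y) t ?J lam"
    using bundle_weights_exist[OF Y_compact Y_convex Y_nonempty idx(2)] by blast
  show ?thesis
  proof (cases "?v \<le> \<epsilon>")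
    case True
    then show ?thesis using mdl_step.terminate[OF w] by blast
  next
    case False
    then have v: "\<epsilon> < ?v" by simp
    show ?thesis
    proof (cases "ereal ?v \<le> ereal \<gamma> * \<Delta> k")
      case True
      let ?J' = "{\<tau>. 1 \<le> \<tau> \<and> \<tau> \<le> t \<and> 0 < lam \<tau>} \<union> {1}"
      obtain z where "strict_level_set Y nrm \<omega> \<omega>' g y ?J' (\<gamma> * ?v) z"
        using strict_level_setI[OF idx(2) _ new_phase_index_set[OF w idx(3,4)] v] by blast
      then obtain x where ps: "prox_step Y \<omega> \<omega>' (level_set Y (lin_form g y) ?J' (\<gamma> * ?v)) center x"
        using strict_level_set.prox_step_exists prox_center_in_dom by blast
      then show ?thesis
        using mdl_step.new_phase[where \<Delta> = \<Delta> and k = k, OF w refl v True refl ps] by blast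
    next
      case False
      obtain z where "strict_level_set Y nrm \<omega> \<omega>' g y ?J (\<gamma> * ?v) z"
        using strict_level_setI[OF idx(2) _ order_refl v] by blast
      moreover have "y t \<in> subdiff_dom Y \<omega>"
        using inv by auto
      ultimately obtain x
        where ps: "prox_step Y \<omega> \<omega>' (level_set Y (lin_form g y) ?J (\<gamma> * ?v)) (y t) x"
        using strict_level_set.prox_step_exists by blast
      then show ?thesis
        using mdl_step.same_phase[where \<Delta> = \<Delta> and k = k, OF w refl v False ps] by blast
    qed
  qed
qed

end

section \<open>Termination and complexity\<close>

theorem proposition3p2:
  fixes Y :: "'a::euclidean_space set"
    and nrm \<omega> :: "'a \<Rightarrow> real" and \<omega>' g :: "'a \<Rightarrow> 'a"
    and L \<epsilon> \<gamma> :: real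
  assumes "Y \<noteq> {}" "convex Y" "compact Y"
    and "is_norm nrm"
    and "dist_gen_fun Y nrm \<omega> \<omega>'"
    and "\<forall>y\<in>Y. dual_norm nrm (g y) \<le> L"
    and "\<epsilon> > 0" "0 < \<gamma>" "\<gamma> < 1"
  shows "(\<nexists>c. c 0 = mdl_start Y \<omega> \<and> (\<forall>n. mdl_step Y \<omega> \<omega>' g \<epsilon> \<gamma> (c n) (c (Suc n)))) \<and>
    (\<forall>n c. (mdl_step Y \<omega> \<omega>' g \<epsilon> \<gamma> ^^ n) (mdl_start Y \<omega>) c \<longrightarrow>
       real n \<le> 2 * (prox_width Y \<omega>)\<^sup>2 * L\<^sup>2 / (\<gamma> ^ 4 * (1 - \<gamma>\<^sup>2) * \<epsilon>\<^sup>2) + 1 \<and>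
       ((\<exists>t P lam. c = Finished t P lam) \<or> (\<exists>c'. mdl_step Y \<omega> \<omega>' g \<epsilon> \<gamma> c c'))) \<and>
    (\<forall>n t P lam. (mdl_step Y \<omega> \<omega>' g \<epsilon> \<gamma> ^^ n) (mdl_start Y \<omega>) (Finished t P lam) \<longrightarrow>
       t = n \<and>
       (\<forall>\<tau>\<in>{1..t}. fst (P \<tau>) \<in> Y \<and> snd (P \<tau>) = g (fst (P \<tau>)) \<and> lam \<tau> \<ge> 0) \<and>
       (\<Sum>\<tau>=1..t. lam \<tau>) = 1 \<and>
       residual Y t P lam \<le> \<epsilon>)"
proof -
  interpret mirror_descent_level Y nrm \<omega> \<omega>' g L \<epsilon> \<gamma>
    using assms by unfold_locales auto
  have bound: "real n \<le> 2 * (prox_width Y \<omega>)\<^sup>2 * L\<^sup>2 / (\<gamma> ^ 4 * (1 - \<gamma>\<^sup>2) * \<epsilon>\<^sup>2) + 1"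
    if "(step ^^ n) (mdl_start Y \<omega>) c" for n c
    using run_steps_le[OF run_invariant[OF that]] .
  have "\<nexists>c. c 0 = mdl_start Y \<omega> \<and> (\<forall>n. step (c n) (c (Suc n)))"
  proof
    assume "\<exists>c. c 0 = mdl_start Y \<omega> \<and> (\<forall>n. step (c n) (c (Suc n)))"
    then obtain c where c: "c 0 = mdl_start Y \<omega>" "\<And>n. step (c n) (c (Suc n))" by blast
    have "(step ^^ n) (mdl_start Y \<omega>) (c n)" for n
      by (induction n) (use c in \<open>auto intro: relpowp_Suc_I\<close>)
    then show False
      using bound by (meson linorder_not_less reals_Archimedean2)
  qed
  moreover have "(\<exists>t P lam. c = Finished t P lam) \<or> (\<exists>c'. step c c')"
    if "(step ^^ n) (mdl_start Y \<omega>) c" for n c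
    using run_invariant[OF that] step_possible by (cases c) auto
  moreover have "invariant n (Finished t P lam)"
    if "(step ^^ n) (mdl_start Y \<omega>) (Finished t P lam)" for n t P lam
    using run_invariant[OF that] .
  ultimately show ?thesis
    using bound by simp
qed

end
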